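(* Let $p\ge1$ be an integer. Let $f=g+h$ on $\mathbb{R}^n$, where $g,h$ are proper closed convex functions, $h$ may be nonsmooth, $g$ is $p$-times continuously differentiable with $\|D^pg(x)-D^pg(y)\|\le L_{p+1}(g)\|x-y\|$ for all $x,y\in\mathbb{R}^n$ (with $L_{p+1}(g)>0$), and the set $X^*$ of minimizers of $f$ is nonempty. Let $\varepsilon>0$, $x_0\in\mathbb{R}^n$, and let $D$ satisfy $\min_{x^*\in X^*}\|x_0-x^*\|\le D$. Consider the high-order AR framework described in the context, with a subroutine $\mathcal{A}$ for solving its subproblems that satisfies the subroutine assumption stated in the context. Suppose that for all $1\le s\le S$ the epoch length satisfies $$N_s\ge\left\lceil4\Big(\tfrac{(p+1)c_{\mathcal{A}}L_{p+1}(g)}{\sigma_s}\Big)^{\frac{2}{3p+1}}\right\rceil,$$ and that $$S:=\Big\lceil\tfrac{2}{3p+1}\log_2\tfrac{c_{\mathcal{A}}D^pL_{p+1}(g)}{\varepsilon}\Big\rceil+1,\qquad\sigma_s:=\frac{2^{\frac{(s-1)(3p+1)}{2}}\varepsilon}{c_{\mathcal{A}}D^p}\quad\text{for all }1\le s\le S.$$ Then the framework can compute an approximate solution $x_S^k$ together with $\nu_S^k$, such that $\nu_S^k\in\partial f(x_S^k)$ and $$\min_{k=N_S+1,\dots,2N_S}\|\nu_S^k\|\le\varepsilon,$$ after at most $$\mathcal{O}\left(\Big[\tfrac{L_{p+1}(g)D^p}{\varepsilon}\Big]^{\frac{2}{3p+1}}\right)$$ calls to the $p$-th-order oracle.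
   Context: $\|\cdot\|$ is the Euclidean norm on $\mathbb{R}^n$, and for symmetric $p$-linear forms the norm it induces. $\partial$ is the convex subdifferential. The $p$-th-order oracle at a point $x$ is $\{f(x),\nabla f(x),\nabla^2f(x),\dots,\nabla^pf(x)\}$. High-order AR (accumulative regularization) framework, in the case of Lipschitz continuous $p$-th derivative. Inputs: total number of epochs $S$, strictly increasing regularization parameters $\{\sigma_s\}_{s=0}^S$ with $\sigma_0=0$, initial point $x_0\in\mathbb{R}^n$. For $s=1,\dots,S$: compute an approximate solution $x_s$ of $$\min_{x\in\mathbb{R}^n}\Big\{f_s(x):=f(x)+\sum_{i=1}^s\tfrac{\sigma_i-\sigma_{i-1}}{p+1}\|x-x_{i-1}\|^{p+1}\Big\}$$ by running the subroutine $\mathcal{A}_s=\mathcal{A}(f,\{\sigma_i\}_{i\le s},\{x_{i-1}\}_{i\le s})$ with initialization $x_{s-1}$ for $N_s$ iterations. $x_s^*$ denotes the exact minimizer of $f_s$, and $x_S^k$ ($k\ge N_S$) denotes the $k$-th iterate of the subroutine in the last epoch $S$. Subroutine assumption. After $N_s$ iterations of $\mathcal{A}_s$, the approximate solution $x_s$ satisfies $$f_s(x_s)-f_s(x_s^* )\le\frac{c_{\mathcal{A}}L_{p+1}(g)\|x_s^*-x_{s-1}\|^{p+1}}{N_s^{\frac{3p+1}{2}}},\qquad\forall\,1\le s\le S.$$ For the $S$-th epoch, for $N_S\le k\le2N_S$, there exists $v_S^k\in\partial f_S(x_S^k)$ such that $$\min_{k=N_S+1,\dots,2N_S}\|v_S^k\|\le\frac{c_{\mathcal{A}}L_{p+1}(g)\|x_S^*-x_{S-1}\|^{p}}{N_S^{\frac{3p}{2}}}.$$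 Here $c_{\mathcal{A}}$ is a universal constant that depends on $\mathcal{A}_s$. The subgradients of $f$ are $\nu_S^k:=v_S^k-\sum_{i=1}^S(\sigma_i-\sigma_{i-1})\|x_S^k-x_{i-1}\|^{p-1}(x_S^k-x_{i-1})\in\partial f(x_S^k)$.
   Formalization: The formal theorem assumes c_A ≥ 4 (the claim fails for small c_A, e.g. 1/4), D > 0 and S ≥ 1; the oracle bound is stated for N_s equal to the ceiling, since a mere lower bound on N_s permits no upper bound, with at most q oracle calls per iteration. *)

theory Defs
  imports "HOL-Analysis.Analysis"
begin

text \<open>Convex analysis for extended-real-valued functions on a Euclidean space.\<close>

definition ereal_epigraph :: "('a \<Rightarrow> ereal) \<Rightarrow> ('a \<times> real) set" where
  "ereal_epigraph f = {(x, t). f x \<le> ereal t}"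

definition proper_closed_convex :: "('a::euclidean_space \<Rightarrow> ereal) \<Rightarrow> bool" where
  "proper_closed_convex f \<longleftrightarrow>
     (\<forall>x. f x \<noteq> - \<infinity>) \<and> (\<exists>x. f x \<noteq> \<infinity>) \<and>
     closed (ereal_epigraph f) \<and> convex (ereal_epigraph f)"

definition subdifferential :: "('a::euclidean_space \<Rightarrow> ereal) \<Rightarrow> 'a \<Rightarrow> 'a set" where
  "subdifferential f x = {v. \<forall>y. f y \<ge> f x + ereal (v \<bullet> (y - x))}"

definition minimizers :: "('a \<Rightarrow> ereal) \<Rightarrow> 'a set" where
  "minimizers f = {x. is_arg_min f (\<lambda>_. True) x}"

text \<open>
  \<open>higher_deriv g [v1, \<dots>, vk] x\<close> is the value of the \<open>k\<close>-linear form \<open>D^k g(x)\<close> at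
  \<open>(v1, \<dots>, vk)\<close>. The space of \<open>k\<close>-linear forms on a Euclidean space is finite-dimensional, so
  \<open>D^k g\<close> is (continuously) Frechet differentiable iff its evaluation at each fixed list of
  directions is; this avoids a type of \<open>k\<close>-linear forms that would depend on \<open>k\<close>.
\<close>

primrec higher_deriv :: "('a::euclidean_space \<Rightarrow> real) \<Rightarrow> 'a list \<Rightarrow> 'a \<Rightarrow> real" where
  "higher_deriv g [] = g"
| "higher_deriv g (v # vs) = (\<lambda>x. frechet_derivative (higher_deriv g vs) (at x) v)"

definition times_continuously_differentiable ::
    "nat \<Rightarrow> ('a::euclidean_space \<Rightarrow> real) \<Rightarrow> bool" where
  "times_continuously_differentiable p g \<longleftrightarrow>
     (\<forall>vs x. length vs < p \<longrightarrow> higher_deriv g vs differentiable at x) \<and>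
     (\<forall>vs. length vs \<le> p \<longrightarrow> continuous_on UNIV (higher_deriv g vs))"

text \<open>The norm of a \<open>p\<close>-linear form induced by the Euclidean norm.\<close>

definition form_norm :: "nat \<Rightarrow> ('a::euclidean_space list \<Rightarrow> real) \<Rightarrow> real" where
  "form_norm p T = (SUP vs\<in>{vs. length vs = p \<and> (\<forall>v\<in>set vs. norm v \<le> 1)}. \<bar>T vs\<bar>)"

text \<open>
  A subroutine receives \<open>f\<close>, the parameters \<open>[\<sigma>\<^sub>0, \<dots>, \<sigma>\<^sub>s]\<close>, the centers
  \<open>[x\<^sub>0, \<dots>, x\<^bsub>s-1\<^esub>]\<close> and an initial point. \<open>iterate\<close> gives its \<open>k\<close>-th iterate, and
  \<open>oracle_calls\<close> the number of calls to the \<open>p\<close>-th-order oracle made in its \<open>k\<close>-th iteration.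
\<close>

record 'a subroutine =
  iterate :: "('a \<Rightarrow> ereal) \<Rightarrow> real list \<Rightarrow> 'a list \<Rightarrow> 'a \<Rightarrow> nat \<Rightarrow> 'a"
  oracle_calls :: "('a \<Rightarrow> ereal) \<Rightarrow> real list \<Rightarrow> 'a list \<Rightarrow> 'a \<Rightarrow> nat \<Rightarrow> nat"

text \<open>\<open>ar_points \<dots> s\<close> is the list \<open>[x\<^sub>0, \<dots>, x\<^sub>s]\<close> of the outputs of the first \<open>s\<close> epochs.\<close>

primrec ar_points :: "'a subroutine \<Rightarrow> ('a \<Rightarrow> ereal) \<Rightarrow> (nat \<Rightarrow> real) \<Rightarrow> (nat \<Rightarrow> nat) \<Rightarrow> 'a \<Rightarrow>
    nat \<Rightarrow> 'a list" where
  "ar_points A f \<sigma> N x0 0 = [x0]"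
| "ar_points A f \<sigma> N x0 (Suc s) =
     (let xs = ar_points A f \<sigma> N x0 s
      in xs @ [iterate A f (map \<sigma> [0..<Suc (Suc s)]) xs (last xs) (N (Suc s))])"

definition ar_point :: "'a subroutine \<Rightarrow> ('a \<Rightarrow> ereal) \<Rightarrow> (nat \<Rightarrow> real) \<Rightarrow> (nat \<Rightarrow> nat) \<Rightarrow> 'a \<Rightarrow>
    nat \<Rightarrow> 'a" where
  "ar_point A f \<sigma> N x0 s = last (ar_points A f \<sigma> N x0 s)"

text \<open>The iterate \<open>x\<^sub>s^k\<close>, and the oracle calls of iteration \<open>k\<close>, of epoch \<open>s \<ge> 1\<close>.\<close>

definition ar_iterate :: "'a subroutine \<Rightarrow> ('a \<Rightarrow> ereal) \<Rightarrow> (nat \<Rightarrow> real) \<Rightarrow> (nat \<Rightarrow> nat) \<Rightarrow> 'a \<Rightarrow>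
    nat \<Rightarrow> nat \<Rightarrow> 'a" where
  "ar_iterate A f \<sigma> N x0 s k =
     iterate A f (map \<sigma> [0..<Suc s]) (ar_points A f \<sigma> N x0 (s - 1))
       (ar_point A f \<sigma> N x0 (s - 1)) k"

definition ar_oracle_calls :: "'a subroutine \<Rightarrow> ('a \<Rightarrow> ereal) \<Rightarrow> (nat \<Rightarrow> real) \<Rightarrow> (nat \<Rightarrow> nat) \<Rightarrow>
    'a \<Rightarrow> nat \<Rightarrow> nat \<Rightarrow> nat" where
  "ar_oracle_calls A f \<sigma> N x0 s k =
     oracle_calls A f (map \<sigma> [0..<Suc s]) (ar_points A f \<sigma> N x0 (s - 1))
       (ar_point A f \<sigma> N x0 (s - 1)) k"

lemma ar_point_0: "ar_point A f \<sigma> N x0 0 = x0"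
  by (simp add: ar_point_def)

lemma ar_point_Suc: "ar_point A f \<sigma> N x0 (Suc s) = ar_iterate A f \<sigma> N x0 (Suc s) (N (Suc s))"
  by (simp add: ar_point_def ar_iterate_def Let_def del: upt_Suc)

lemma ar_points_eq: "ar_points A f \<sigma> N x0 s = map (ar_point A f \<sigma> N x0) [0..<Suc s]"
proof (induction s)
  case 0
  show ?case by (simp add: ar_point_def)
next
  case (Suc s)
  have "ar_points A f \<sigma> N x0 (Suc s) = ar_points A f \<sigma> N x0 s @ [ar_point A f \<sigma> N x0 (Suc s)]"
    by (simp add: ar_point_def Let_def del: upt_Suc)
  also have "\<dots> = map (ar_point A f \<sigma> N x0) [0..<Suc (Suc s)]"
    by (subst Suc.IH) simp
  finally show ?case .
qed

text \<open>The last epoch \<open>S\<close> is continued up to iteration \<open>2 N\<^sub>S\<close>.\<close>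

definition ar_total_oracle_calls :: "'a subroutine \<Rightarrow> ('a \<Rightarrow> ereal) \<Rightarrow> (nat \<Rightarrow> real) \<Rightarrow>
    (nat \<Rightarrow> nat) \<Rightarrow> 'a \<Rightarrow> nat \<Rightarrow> nat" where
  "ar_total_oracle_calls A f \<sigma> N x0 S =
     (\<Sum>s = 1..<S. \<Sum>k = 1..N s. ar_oracle_calls A f \<sigma> N x0 s k) +
     (\<Sum>k = 1..2 * N S. ar_oracle_calls A f \<sigma> N x0 S k)"

text \<open>The objective \<open>f\<^sub>s\<close> of epoch \<open>s\<close>, for centers \<open>x\<close>, and its exact minimizer.\<close>

definition ar_objective :: "nat \<Rightarrow> ('a::euclidean_space \<Rightarrow> ereal) \<Rightarrow> (nat \<Rightarrow> real) \<Rightarrow>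
    (nat \<Rightarrow> 'a) \<Rightarrow> nat \<Rightarrow> 'a \<Rightarrow> ereal" where
  "ar_objective p f \<sigma> x s z =
     f z + ereal (\<Sum>i = 1..s. (\<sigma> i - \<sigma> (i - 1)) / (real p + 1) * norm (z - x (i - 1)) ^ (p + 1))"

definition ar_minimizer :: "nat \<Rightarrow> ('a::euclidean_space \<Rightarrow> ereal) \<Rightarrow> (nat \<Rightarrow> real) \<Rightarrow>
    (nat \<Rightarrow> 'a) \<Rightarrow> nat \<Rightarrow> 'a" where
  "ar_minimizer p f \<sigma> x s = arg_min (ar_objective p f \<sigma> x s) (\<lambda>_. True)"

definition ar_min_epoch_length :: "nat \<Rightarrow> real \<Rightarrow> real \<Rightarrow> real \<Rightarrow> int" where
  "ar_min_epoch_length p c L \<sigma> =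
     \<lceil>4 * ((real p + 1) * c * L / \<sigma>) powr (2 / (3 * real p + 1))\<rceil>"

text \<open>
  The value used for the constant hidden in the complexity bound, where \<open>q\<close> bounds the number of oracle
  calls per iteration. It is given explicitly because an existentially quantified constant in a
  statement about \<open>real ^ 'n\<close> could depend on the dimension.
\<close>

definition ar_oracle_constant :: "nat \<Rightarrow> real \<Rightarrow> nat \<Rightarrow> real" where
  "ar_oracle_constant p c q = 16 * real q * ((real p + 1) * c\<^sup>2) powr (2 / (3 * real p + 1))"

end

(* Let phi = |.|^(p+1) / (p+1), let d_s be the distance of the exact minimizer of epoch s from the
   last center x_{s-1}, and let kappa = 2^((3p+1)/2) be the ratio of consecutive sigma_s. The length
   of epoch s makes its value gap at most sigma_s d_s^(p+1) / ((p+1) kappa^2). Optimality of the exact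
   minimizers bounds the Bregman divergence of phi by that gap, and the divergence at b from a is at
   least |a|^(p-1) |b-a|^2 / 2. Hence x_s is within rho d_s of the exact minimizer with rho of order
   1/kappa, and d_{s+1} <= tau d_s with kappa tau^p < 1, so that the terms sigma_s d_s^p are summable
   against eps. Uniform convexity of phi with its global constant 2^(1-p) would not suffice: it only
   gives rho = 1/4, and then |y - x_{i-1}|^p loses a factor exponential in p. In the last epoch the
   same divergence bound controls the iterate with the smallest subgradient. *)

theory Submission
  imports Defs
begin

section \<open>Bregman divergence of powers of the norm\<close>

text \<open>This is the tangent-line inequality of the convex function
  \<open>t powr ((m + 2) / 2)\<close>, taken at \<open>a\<^sup>2\<close> and evaluated at
  \<open>b\<^sup>2\<close>; the induction stays within natural powers.\<close>

lemma power_tangent_square: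
  fixes a b :: real
  assumes "a \<ge> 0" "b \<ge> 0"
  shows "(real m + 2) * a ^ m * b\<^sup>2 \<le> 2 * b ^ (m + 2) + real m * a ^ (m + 2)"
proof (induction m)
  case 0
  then show ?case by (simp add: power2_eq_square)
next
  case (Suc m)
  \<comment> \<open>The product is exactly the slack of the claim for \<open>Suc m\<close> minus
    \<open>a\<close> times the slack of the induction hypothesis. Its two factors have the same
    sign.\<close>
  have "0 \<le> (b - a) * (2 * b ^ (m + 2) - a ^ (m + 1) * b - a ^ (m + 2))"
  proof (cases "a \<le> b")
    case True
    have "a ^ (m + 1) * b \<le> b ^ (m + 1) * b" "a ^ (m + 2) \<le> b ^ (m + 2)"
      using True assms by (intro mult_right_mono power_mono; simp)+
    then have "a ^ (m + 1) * b + a ^ (m + 2) \<le> 2 * b ^ (m + 2)" by (simp add: algebra_simps)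
    then show ?thesis using True by (intro mult_nonneg_nonneg) auto
  next
    case False
    have "b ^ (m + 1) * b \<le> a ^ (m + 1) * b" "b ^ (m + 2) \<le> a ^ (m + 2)"
      using False assms by (intro mult_right_mono power_mono; simp)+
    then have "2 * b ^ (m + 2) \<le> a ^ (m + 1) * b + a ^ (m + 2)" by (simp add: algebra_simps)
    then show ?thesis using False by (intro mult_nonpos_nonpos) auto
  qed
  moreover have "a * ((real m + 2) * a ^ m * b\<^sup>2) \<le> a * (2 * b ^ (m + 2) + real m * a ^ (m + 2))"
    using Suc assms by (intro mult_left_mono) auto
  ultimately show ?case by (simp add: algebra_simps power2_eq_square)
qed

text \<open>The potential is \<open>norm a ^ (p + 1) / (real p + 1)\<close>, with gradient
  \<open>norm a ^ (p - 1) *\<^sub>R a\<close>; the second argument \<open>a\<close> is the base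
  point.\<close>

definition power_bregman :: "nat \<Rightarrow> 'a::real_inner \<Rightarrow> 'a \<Rightarrow> real" where
  "power_bregman p b a =
     (norm b ^ (p + 1) - norm a ^ (p + 1)) / (real p + 1) - norm a ^ (p - 1) * (a \<bullet> (b - a))"

text \<open>Polarization splits off the quadratic term exactly; what remains depends only on the two
  norms and is nonnegative by \<open>power_tangent_square\<close>.\<close>

lemma power_bregman_ge:
  assumes "p \<ge> 1"
  shows "power_bregman p b a \<ge> norm a ^ (p - 1) * (norm (b - a))\<^sup>2 / 2"
proof -
  obtain m where m: "p = Suc m" using assms by (metis Suc_le_D One_nat_def)
  have ab: "a \<bullet> (b - a) = ((norm b)\<^sup>2 - (norm a)\<^sup>2 - (norm (b - a))\<^sup>2) / 2"
    by (simp add: power2_norm_eq_inner inner_diff inner_commute)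
  have "(real m + 2) * norm a ^ m * (norm b)\<^sup>2 \<le> 2 * norm b ^ (m + 2) + real m * norm a ^ (m + 2)"
    by (rule power_tangent_square) auto
  then have "norm a ^ m * ((norm b)\<^sup>2 - (norm a)\<^sup>2) / 2
      \<le> (norm b ^ (m + 2) - norm a ^ (m + 2)) / (real m + 2)"
    by (simp add: field_simps power2_eq_square)
  moreover have "power_bregman p b a = (norm b ^ (m + 2) - norm a ^ (m + 2)) / (real m + 2)
      - norm a ^ m * ((norm b)\<^sup>2 - (norm a)\<^sup>2) / 2 + norm a ^ m * (norm (b - a))\<^sup>2 / 2"
    unfolding power_bregman_def ab m by (simp add: field_simps)
  ultimately show ?thesis by (simp add: m)
qed

lemma power_bregman_nonneg: "p \<ge> 1 \<Longrightarrow> power_bregman p b a \<ge> 0"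
  by (rule order_trans[OF _ power_bregman_ge]) auto

lemma power_bregman_0: "p \<ge> 1 \<Longrightarrow> power_bregman p b 0 = norm b ^ (p + 1) / (real p + 1)"
  by (simp add: power_bregman_def)

text \<open>Turns a value gap into a distance relative to \<open>norm a\<close>: the factor
  \<open>norm a ^ (p - 1)\<close> of the quadratic bound cancels. At \<open>a = 0\<close> this
  factor may vanish, but there the divergence is a pure power of \<open>norm b\<close>.\<close>

lemma dist_le_of_power_bregman_le:
  assumes p: "p \<ge> 1" and \<rho>: "\<rho> \<ge> 0"
    and le: "power_bregman p b a \<le> \<rho>\<^sup>2 / 2 * norm a ^ (p + 1)"
  shows "norm (b - a) \<le> \<rho> * norm a"
proof (cases "a = 0")
  case True
  then have "norm b ^ (p + 1) \<le> 0" using le p by (simp add: power_bregman_0 divide_le_0_iff)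
  then have "norm b = 0" by (metis norm_ge_zero power_eq_0_iff zero_le_power order_antisym)
  then show ?thesis using True by simp
next
  case False
  obtain m where m: "p = Suc m" using p by (metis Suc_le_D One_nat_def)
  have "norm a ^ m * (norm (b - a))\<^sup>2 \<le> norm a ^ m * (\<rho> * norm a)\<^sup>2"
    using power_bregman_ge[OF p, of a b] le by (simp add: m power2_eq_square algebra_simps)
  then have "(norm (b - a))\<^sup>2 \<le> (\<rho> * norm a)\<^sup>2" using False by simp
  then show ?thesis by (rule power2_le_imp_le) (use \<rho> in simp)
qed

text \<open>Counterpart for bounds that come from a subgradient by Cauchy-Schwarz: the right side is
  linear in the distance, so one factor of the distance cancels as well.\<close>

lemma dist_le_of_power_bregman_le_dist:
  assumes p: "p \<ge> 1" and \<rho>: "\<rho> \<ge> 0"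
    and le: "power_bregman p b a \<le> \<rho> / 2 * norm a ^ p * norm (b - a)"
  shows "norm (b - a) \<le> \<rho> * norm a"
proof (cases "a = 0 \<or> b = a")
  case True
  show ?thesis
  proof (cases "b = a")
    case False
    then have "norm b ^ (p + 1) \<le> 0" using True le p by (simp add: power_bregman_0 divide_le_0_iff power_0_left)
    then have "norm b = 0" by (metis norm_ge_zero power_eq_0_iff zero_le_power order_antisym)
    then show ?thesis using True False by simp
  qed (use \<rho> in simp)
next
  case False
  obtain m where m: "p = Suc m" using p by (metis Suc_le_D One_nat_def)
  have "norm a ^ m * norm (b - a) * norm (b - a) \<le> norm a ^ m * norm (b - a) * (\<rho> * norm a)"
    using power_bregman_ge[OF p, of a b] le by (simp add: m power2_eq_square algebra_simps)
  then show ?thesis using False by simp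
qed

section \<open>Extended-real convex functions through their epigraphs\<close>

lemma ereal_epigraph_convexD:
  assumes "convex (ereal_epigraph F)" "F a \<le> ereal \<alpha>" "F b \<le> ereal \<beta>" "0 \<le> t" "t \<le> 1"
  shows "F ((1 - t) *\<^sub>R a + t *\<^sub>R b) \<le> ereal ((1 - t) * \<alpha> + t * \<beta>)"
proof -
  have "(1 - t) *\<^sub>R (a, \<alpha>) + t *\<^sub>R (b, \<beta>) \<in> ereal_epigraph F"
    using assms by (intro convexD_alt) (auto simp: ereal_epigraph_def)
  then show ?thesis by (simp add: ereal_epigraph_def)
qed

lemma ereal_add_le_iff: "ereal r + w \<le> ereal t \<longleftrightarrow> w \<le> ereal (t - r)"
  by (cases w) auto

text \<open>Adding a finite continuous function shears the epigraph, so the new epigraph is the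
  preimage of the old one under a continuous map.\<close>

lemma closed_ereal_epigraph_add:
  fixes r :: "'a::euclidean_space \<Rightarrow> real"
  assumes "closed (ereal_epigraph F)" "continuous_on UNIV r"
  shows "closed (ereal_epigraph (\<lambda>z. ereal (r z) + F z))"
proof -
  have "ereal_epigraph (\<lambda>z. ereal (r z) + F z) = (\<lambda>w. (fst w, snd w - r (fst w))) -` ereal_epigraph F"
    by (auto simp: ereal_epigraph_def ereal_add_le_iff)
  moreover have "continuous_on UNIV (\<lambda>w. (fst w, snd w - r (fst w)))"
    by (intro continuous_intros continuous_on_compose2[OF assms(2)]) auto
  ultimately show ?thesis using closed_vimage[OF assms(1)] by simp
qed

lemma convex_ereal_epigraph_add:
  assumes "convex (ereal_epigraph F)" "convex (ereal_epigraph (\<lambda>z. ereal (r z)))"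
  shows "convex (ereal_epigraph (\<lambda>z. ereal (r z) + F z))"
  unfolding convex_alt
proof safe
  fix a b :: 'a and \<alpha> \<beta> t :: real
  assume *: "(a, \<alpha>) \<in> ereal_epigraph (\<lambda>z. ereal (r z) + F z)"
    "(b, \<beta>) \<in> ereal_epigraph (\<lambda>z. ereal (r z) + F z)" and t: "0 \<le> t" "t \<le> 1"
  let ?z = "(1 - t) *\<^sub>R a + t *\<^sub>R b"
  have "F ?z \<le> ereal ((1 - t) * (\<alpha> - r a) + t * (\<beta> - r b))"
    using * t by (intro ereal_epigraph_convexD assms) (auto simp: ereal_epigraph_def ereal_add_le_iff)
  moreover have "ereal (r ?z) \<le> ereal ((1 - t) * r a + t * r b)"
    using ereal_epigraph_convexD[OF assms(2), of a "r a" b "r b" t] t by simp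
  ultimately have "ereal (r ?z) + F ?z \<le> ereal ((1 - t) * r a + t * r b)
      + ereal ((1 - t) * (\<alpha> - r a) + t * (\<beta> - r b))"
    by (rule add_mono[rotated])
  then show "(1 - t) *\<^sub>R (a, \<alpha>) + t *\<^sub>R (b, \<beta>) \<in> ereal_epigraph (\<lambda>z. ereal (r z) + F z)"
    by (simp add: ereal_epigraph_def algebra_simps)
qed

text \<open>Lower semicontinuity is encoded as closedness of the epigraph, so the continuous height
  coordinate \<open>snd\<close> is minimized over a compact piece of the epigraph instead of
  \<open>F\<close> over a ball.\<close>

lemma exists_arg_min_of_coercive:
  fixes F :: "'a::euclidean_space \<Rightarrow> ereal"
  assumes cl: "closed (ereal_epigraph F)" and z0: "F z0 \<noteq> \<infinity>"
    and low: "\<And>z. F z \<ge> ereal (m + a * norm (z - u) ^ (p + 1))" and a: "a > 0"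
  shows "\<exists>z. is_arg_min F (\<lambda>_. True) z"
proof -
  have fin: "F z \<noteq> - \<infinity>" for z using low[of z] by auto
  obtain t0 where t0: "F z0 = ereal t0" using z0 fin[of z0] by (cases "F z0") auto
  \<comment> \<open>A radius of at least 1 makes the power \<open>p + 1\<close> dominate the first
    power, so the linear bound with \<open>(t0 - m) / a\<close> suffices.\<close>
  define \<rho> where "\<rho> = max 1 ((t0 - m) / a)"
  have near: "dist u z \<le> \<rho>" if "F z \<le> ereal t0" for z
  proof (rule ccontr)
    assume "\<not> ?thesis"
    then have "norm (z - u) > 1" "(t0 - m) / a < norm (z - u)"
      by (auto simp: \<rho>_def dist_norm norm_minus_commute)
    then have n: "norm (z - u) > 1" "a * norm (z - u) > t0 - m"
      using a by (simp_all add: field_simps)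
    then have "norm (z - u) ^ 1 \<le> norm (z - u) ^ (p + 1)" by (intro power_increasing) auto
    then have "a * norm (z - u) \<le> a * norm (z - u) ^ (p + 1)" using a by simp
    then have "t0 < m + a * norm (z - u) ^ (p + 1)" using n by simp
    then show False using low[of z] that by (metis ereal_less_eq(3) not_le order_trans)
  qed
  have lowm: "m \<le> t" if "F z \<le> ereal t" for z t
  proof -
    have "m + a * norm (z - u) ^ (p + 1) \<le> t" using low[of z] that
      by (metis ereal_less_eq(3) order_trans)
    moreover have "0 \<le> a * norm (z - u) ^ (p + 1)" using a by simp
    ultimately show ?thesis by linarith
  qed
  define K where "K = ereal_epigraph F \<inter> (cball u \<rho> \<times> {m..t0})"
  have "compact K" unfolding K_def
    by (intro closed_Int_compact cl compact_Times) auto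
  moreover have "(z0, t0) \<in> K"
    using t0 near[of z0] lowm[of z0 t0] by (auto simp: K_def ereal_epigraph_def)
  ultimately obtain w where w: "w \<in> K" "\<And>w'. w' \<in> K \<Longrightarrow> snd w \<le> snd w'"
    using continuous_attains_inf[of K snd] continuous_on_snd[OF continuous_on_id]
    by (metis empty_iff)
  have "\<not> F z < F (fst w)" for z
  proof
    assume lt: "F z < F (fst w)"
    have Fw: "F (fst w) \<le> ereal (snd w)" "snd w \<le> t0"
      using w(1) by (auto simp: K_def ereal_epigraph_def)
    obtain t where t: "F z = ereal t" using lt fin[of z] by (cases "F z") auto
    have tw: "t < snd w" using lt Fw t by (metis ereal_less(2) less_ereal.simps(1) order_less_le_trans)
    then have "(z, t) \<in> K"
      using t Fw near[of z] lowm[of z t] by (auto simp: K_def ereal_epigraph_def)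
    then show False using w(2)[of "(z, t)"] tw by simp
  qed
  then show ?thesis by (auto simp: is_arg_min_def)
qed

text \<open>The minimizers form the slice of the epigraph at the minimal height. Closedness lets the
  distance from \<open>x0\<close> be attained at an actual minimizer.\<close>

lemma closed_minimizers:
  assumes cl: "closed (ereal_epigraph F)" and fin: "\<And>z. F z \<noteq> - \<infinity>" and z0: "F z0 \<noteq> \<infinity>"
  shows "closed (minimizers F)"
proof (cases "minimizers F = {}")
  case False
  then obtain z where z: "\<And>w. F z \<le> F w" by (auto simp: minimizers_def is_arg_min_def not_less)
  obtain t where t: "F z = ereal t" using fin[of z] z[of z0] z0 by (cases "F z") auto
  have "(\<forall>w'. F w \<le> F w') \<longleftrightarrow> F w \<le> ereal t" for w
    using z t by (metis order_trans)
  then have "minimizers F = (\<lambda>w. (w, t)) -` ereal_epigraph F"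
    by (auto simp: minimizers_def is_arg_min_def not_less ereal_epigraph_def)
  moreover have "continuous_on UNIV (\<lambda>w. (w, t))" by (intro continuous_intros)
  ultimately show ?thesis using closed_vimage[OF cl] by simp
qed simp

text \<open>
  The gradient inequality at the displaced point \<open>y + t (z - y)\<close>, with \<open>t \<longlongrightarrow> 0\<close>, replaces
  differentiability of \<open>R\<close>: only continuity of \<open>G\<close> is needed.
\<close>

lemma subdifferential_diff_gradient:
  fixes F :: "'a::euclidean_space \<Rightarrow> ereal"
  assumes conv: "convex (ereal_epigraph F)" and fin: "\<And>z. F z \<noteq> - \<infinity>" and z0: "F z0 \<noteq> \<infinity>"
    and G: "continuous_on UNIV G" and grad: "\<And>a b. R a \<ge> R b + G b \<bullet> (a - b)"
    and v: "v \<in> subdifferential (\<lambda>z. F z + ereal (R z)) y"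
  shows "F y \<noteq> \<infinity>" "v - G y \<in> subdifferential F y"
proof -
  have sub: "F y + ereal (R y) + ereal (v \<bullet> (z - y)) \<le> F z + ereal (R z)" for z
    using v by (simp add: subdifferential_def)
  show Fy: "F y \<noteq> \<infinity>" using sub[of z0] z0 by auto
  obtain s where s: "F y = ereal s" using Fy fin[of y] by (cases "F y") auto
  have "F y + ereal ((v - G y) \<bullet> (z - y)) \<le> F z" for z
  proof (cases "F z")
    case (real r)
    have *: "(v - G (y + t *\<^sub>R (z - y))) \<bullet> (z - y) \<le> r - s" if t: "0 < t" "t < 1" for t
    proof -
      let ?w = "y + t *\<^sub>R (z - y)"
      have eq: "(1 - t) *\<^sub>R y + t *\<^sub>R z = ?w" by (simp add: algebra_simps)
      have "F ?w \<le> ereal ((1 - t) * s + t * r)"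
        using ereal_epigraph_convexD[OF conv, of y s z r t] s real t by (simp add: eq)
      then have "F ?w + ereal (R ?w) \<le> ereal ((1 - t) * s + t * r) + ereal (R ?w)"
        by (rule add_right_mono)
      from order_trans[OF sub[of ?w] this]
      have "s + R y + t * (v \<bullet> (z - y)) \<le> (1 - t) * s + t * r + R ?w" by (simp add: s)
      moreover have "R ?w \<le> R y + t * (G ?w \<bullet> (z - y))"
        using grad[of ?w y] by (simp add: inner_diff_right algebra_simps)
      ultimately have "t * (v \<bullet> (z - y) - G ?w \<bullet> (z - y)) \<le> t * (r - s)" by (simp add: algebra_simps)
      then show ?thesis using t by (simp add: inner_diff_left)
    qed
    have "continuous_on UNIV (\<lambda>t. (v - G (y + t *\<^sub>R (z - y))) \<bullet> (z - y))"
      by (intro continuous_intros continuous_on_compose2[OF G]) auto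
    then have "isCont (\<lambda>t. (v - G (y + t *\<^sub>R (z - y))) \<bullet> (z - y)) 0"
      by (simp add: continuous_on_eq_continuous_at)
    then have "((\<lambda>t. (v - G (y + t *\<^sub>R (z - y))) \<bullet> (z - y)) \<longlongrightarrow> (v - G y) \<bullet> (z - y)) (at 0)"
      by (simp add: isCont_def)
    \<comment> \<open>The estimate is available only for \<open>0 < t < 1\<close>, hence the
      one-sided limit.\<close>
    then have "((\<lambda>t. (v - G (y + t *\<^sub>R (z - y))) \<bullet> (z - y)) \<longlongrightarrow> (v - G y) \<bullet> (z - y)) (at_right 0)"
      by (rule tendsto_within_subset) simp
    moreover have "\<forall>\<^sub>F t in at_right 0. (v - G (y + t *\<^sub>R (z - y))) \<bullet> (z - y) \<le> r - s"
      unfolding eventually_at_right_field using * by (intro exI[of _ 1]) auto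
    ultimately have "(v - G y) \<bullet> (z - y) \<le> r - s"
      by (rule tendsto_upperbound) simp
    then show ?thesis by (simp add: s real)
  qed (use fin in auto)
  then show "v - G y \<in> subdifferential F y" by (simp add: subdifferential_def)
qed

section \<open>The regularizer and its gradient\<close>

text \<open>Written exactly as the correction subtracted in \<nu>, so that the subgradients of
  \<open>f\<close> become \<open>v k - ar_gradient p \<sigma> x S (y k)\<close>.\<close>

definition ar_gradient :: "nat \<Rightarrow> (nat \<Rightarrow> real) \<Rightarrow> (nat \<Rightarrow> 'a) \<Rightarrow> nat \<Rightarrow> 'a \<Rightarrow> 'a::real_inner" where
  "ar_gradient p \<sigma> x s z =
     (\<Sum>i = 1..s. ((\<sigma> i - \<sigma> (i - 1)) * norm (z - x (i - 1)) ^ (p - 1)) *\<^sub>R (z - x (i - 1)))"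

definition ar_regularizer :: "nat \<Rightarrow> (nat \<Rightarrow> real) \<Rightarrow> (nat \<Rightarrow> 'a) \<Rightarrow> nat \<Rightarrow> 'a::real_inner \<Rightarrow> real" where
  "ar_regularizer p \<sigma> x s z =
     (\<Sum>i = 1..s. (\<sigma> i - \<sigma> (i - 1)) / (real p + 1) * norm (z - x (i - 1)) ^ (p + 1))"

lemma ar_objective_eq: "ar_objective p f \<sigma> x s = (\<lambda>z. f z + ereal (ar_regularizer p \<sigma> x s z))"
  by (simp add: ar_objective_def ar_regularizer_def fun_eq_iff)

lemma ar_regularizer_Suc:
  "ar_regularizer p \<sigma> x (Suc s) z = ar_regularizer p \<sigma> x s z
     + (\<sigma> (Suc s) - \<sigma> s) / (real p + 1) * norm (z - x s) ^ (p + 1)"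
  by (simp add: ar_regularizer_def)

lemma ar_regularizer_expand:
  "ar_regularizer p \<sigma> x s a = ar_regularizer p \<sigma> x s b + ar_gradient p \<sigma> x s b \<bullet> (a - b)
     + (\<Sum>i = 1..s. (\<sigma> i - \<sigma> (i - 1)) * power_bregman p (a - x (i - 1)) (b - x (i - 1)))"
  unfolding ar_regularizer_def ar_gradient_def inner_sum_left sum.distrib[symmetric]
  by (intro sum.cong refl) (simp add: power_bregman_def algebra_simps diff_divide_distrib)

lemma continuous_on_ar_gradient: "continuous_on UNIV (ar_gradient p \<sigma> x s)"
  unfolding ar_gradient_def by (intro continuous_intros)

lemma continuous_on_ar_regularizer: "continuous_on UNIV (ar_regularizer p \<sigma> x s)"
  unfolding ar_regularizer_def by (intro continuous_intros)

section \<open>Epoch-wise optimality for arbitrary centers and increasing weights\<close>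

locale accumulative_regularization =
  fixes p S :: nat and f :: "'a::euclidean_space \<Rightarrow> ereal" and \<sigma> :: "nat \<Rightarrow> real"
    and x xs :: "nat \<Rightarrow> 'a" and xstar :: 'a
  assumes p: "p \<ge> 1"
    and f: "proper_closed_convex f"
    and xstar: "xstar \<in> minimizers f"
    and sigma_increasing: "i \<in> {1..S} \<Longrightarrow> \<sigma> (i - 1) < \<sigma> i"
    and xs: "xs = ar_minimizer p f \<sigma> x"
begin

abbreviation "R \<equiv> ar_regularizer p \<sigma> x"
abbreviation "G \<equiv> ar_gradient p \<sigma> x"

text \<open>\<open>real_of_ereal\<close> sends infinite values to 0, so \<open>val\<close> is
  meaningful only where \<open>f\<close> is finite; this is the reason for the finiteness hypotheses
  below.\<close>

definition val :: "'a \<Rightarrow> real" where "val z = real_of_ereal (f z)"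

definition gap :: "nat \<Rightarrow> 'a \<Rightarrow> real" where
  "gap s z = val z + R s z - (val (xs s) + R s (xs s))"

lemma not_MInfty: "f z \<noteq> - \<infinity>" and proper: "\<exists>z. f z \<noteq> \<infinity>"
  and closed: "closed (ereal_epigraph f)" and convex: "convex (ereal_epigraph f)"
  using f by (auto simp: proper_closed_convex_def)

lemma f_eq_val: "f z \<noteq> \<infinity> \<Longrightarrow> f z = ereal (val z)"
  using not_MInfty[of z] by (cases "f z") (auto simp: val_def)

lemma xstar_le: "f xstar \<le> f z"
  using xstar by (auto simp: minimizers_def is_arg_min_def not_less)

lemma xstar_finite: "f xstar \<noteq> \<infinity>"
  using proper xstar_le by (metis ereal_infty_less_eq(1))

text \<open>All terms are nonnegative, and keeping the last one loses little: under the geometric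
  schedule its weight is at least 3/4 of \<open>\<sigma> s\<close>.\<close>

lemma bregman_sum_ge:
  assumes "1 \<le> s" "s \<le> S"
  shows "(\<sigma> s - \<sigma> (s - 1)) * power_bregman p (a - x (s - 1)) (b - x (s - 1))
    \<le> (\<Sum>i = 1..s. (\<sigma> i - \<sigma> (i - 1)) * power_bregman p (a - x (i - 1)) (b - x (i - 1)))"
proof (rule member_le_sum)
  show "0 \<le> (\<sigma> i - \<sigma> (i - 1)) * power_bregman p (a - x (i - 1)) (b - x (i - 1))"
    if "i \<in> {1..s} - {s}" for i
    using sigma_increasing[of i] that assms p
    by (intro mult_nonneg_nonneg power_bregman_nonneg) auto
qed (use assms in auto)

lemma regularizer_ge:
  assumes "1 \<le> s" "s \<le> S"
  shows "R s a \<ge> R s b + G s b \<bullet> (a - b)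
    + (\<sigma> s - \<sigma> (s - 1)) * power_bregman p (a - x (s - 1)) (b - x (s - 1))"
  using ar_regularizer_expand[of p \<sigma> x s a b] bregman_sum_ge[OF assms, of a b] by simp

lemma regularizer_gradient_inequality:
  assumes "s \<le> S"
  shows "R s a \<ge> R s b + G s b \<bullet> (a - b)"
proof (cases "1 \<le> s")
  case True
  have "0 \<le> (\<sigma> s - \<sigma> (s - 1)) * power_bregman p (a - x (s - 1)) (b - x (s - 1))"
    using sigma_increasing[of s] True assms p by (intro mult_nonneg_nonneg power_bregman_nonneg) auto
  then show ?thesis using regularizer_ge[OF True assms, of b a] by simp
next
  case False
  then have "s = 0" by simp
  then show ?thesis by (simp add: ar_regularizer_def ar_gradient_def)
qed

lemma regularizer_ge_last:
  assumes "1 \<le> s" "s \<le> S"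
  shows "R s z \<ge> (\<sigma> s - \<sigma> (s - 1)) / (real p + 1) * norm (z - x (s - 1)) ^ (p + 1)"
proof -
  have "0 \<le> (\<sigma> i - \<sigma> (i - 1)) / (real p + 1) * norm (z - x (i - 1)) ^ (p + 1)"
    if "i \<in> {1..s} - {s}" for i
    using sigma_increasing[of i] that assms by (intro mult_nonneg_nonneg divide_nonneg_nonneg) auto
  then show ?thesis unfolding ar_regularizer_def
    by (intro member_le_sum[of s "{1..s}" "\<lambda>i. (\<sigma> i - \<sigma> (i - 1)) / (real p + 1) * norm (z - x (i - 1)) ^ (p + 1)"])
      (use assms in auto)
qed

text \<open>\<open>ar_minimizer\<close> is a choice, so existence comes first: \<open>f\<close> is
  bounded below by its minimum, and the last regularization term supplies coercivity.\<close>

lemma xs_minimizes: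
  assumes "1 \<le> s" "s \<le> S"
  shows "f (xs s) + ereal (R s (xs s)) \<le> f z + ereal (R s z)"
proof -
  define m where "m = val xstar"
  have "\<exists>z. is_arg_min (\<lambda>z. ereal (R s z) + f z) (\<lambda>_. True) z"
  proof (rule exists_arg_min_of_coercive)
    show "closed (ereal_epigraph (\<lambda>z. ereal (R s z) + f z))"
      by (intro closed_ereal_epigraph_add closed continuous_on_ar_regularizer)
    show "ereal (R s xstar) + f xstar \<noteq> \<infinity>" using xstar_finite by simp
    show "(\<sigma> s - \<sigma> (s - 1)) / (real p + 1) > 0" using sigma_increasing[of s] assms by simp
    show "ereal (m + (\<sigma> s - \<sigma> (s - 1)) / (real p + 1) * norm (z - x (s - 1)) ^ (p + 1))
        \<le> ereal (R s z) + f z" for z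
    proof -
      have "ereal m \<le> f z" using xstar_le[of z] f_eq_val[OF xstar_finite] by (simp add: m_def)
      moreover have "ereal ((\<sigma> s - \<sigma> (s - 1)) / (real p + 1) * norm (z - x (s - 1)) ^ (p + 1))
          \<le> ereal (R s z)" using regularizer_ge_last[OF assms] by simp
      ultimately have "ereal ((\<sigma> s - \<sigma> (s - 1)) / (real p + 1) * norm (z - x (s - 1)) ^ (p + 1)) + ereal m
          \<le> ereal (R s z) + f z" by (rule add_mono[rotated])
      then show ?thesis by (simp add: add.commute)
    qed
  qed
  then have "\<exists>z. is_arg_min (ar_objective p f \<sigma> x s) (\<lambda>_. True) z"
    by (simp add: ar_objective_eq add.commute)
  then have "is_arg_min (ar_objective p f \<sigma> x s) (\<lambda>_. True) (xs s)"
    unfolding xs ar_minimizer_def arg_min_def by (rule someI_ex)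
  then show ?thesis by (auto simp: is_arg_min_def not_less ar_objective_eq)
qed

lemma xs_finite:
  assumes "1 \<le> s" "s \<le> S"
  shows "f (xs s) \<noteq> \<infinity>"
  using xs_minimizes[OF assms, of xstar] xstar_finite by auto

lemma xs_minimizes_val:
  assumes "1 \<le> s" "s \<le> S" "f z \<noteq> \<infinity>"
  shows "val (xs s) + R s (xs s) \<le> val z + R s z"
  using xs_minimizes[OF assms(1,2), of z] f_eq_val[OF assms(3)] f_eq_val[OF xs_finite[OF assms(1,2)]]
  by simp

lemma subdifferential_objective:
  assumes "s \<le> S" "v \<in> subdifferential (ar_objective p f \<sigma> x s) y"
  shows "f y \<noteq> \<infinity>" "v - G s y \<in> subdifferential f y"
  using subdifferential_diff_gradient[OF convex not_MInfty xstar_finite continuous_on_ar_gradient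
      regularizer_gradient_inequality[OF assms(1)], of v y] assms(2)
  by (auto simp: ar_objective_eq)

text \<open>By Fermat's rule 0 is a subgradient at \<open>xs s\<close>, so
  \<open>- G s (xs s)\<close> is a subgradient of \<open>f\<close> there. The linear terms cancel in
  the gap, and the divergence is left.\<close>

lemma gap_ge_bregman:
  assumes s: "1 \<le> s" "s \<le> S" and z: "f z \<noteq> \<infinity>"
  shows "(\<sigma> s - \<sigma> (s - 1)) * power_bregman p (z - x (s - 1)) (xs s - x (s - 1)) \<le> gap s z"
proof -
  have "0 \<in> subdifferential (ar_objective p f \<sigma> x s) (xs s)"
    using xs_minimizes[OF s] by (simp add: subdifferential_def ar_objective_eq)
  from subdifferential_objective(2)[OF s(2) this]
  have "f (xs s) + ereal (- (G s (xs s) \<bullet> (z - xs s))) \<le> f z"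
    by (simp add: subdifferential_def)
  then have "val (xs s) - G s (xs s) \<bullet> (z - xs s) \<le> val z"
    by (simp add: f_eq_val[OF z] f_eq_val[OF xs_finite[OF s]])
  then show ?thesis using regularizer_ge[OF s, of "xs s" z] by (simp add: gap_def)
qed

lemma inner_subgradient_ge_gap:
  assumes s: "1 \<le> s" "s \<le> S" and v: "v \<in> subdifferential (ar_objective p f \<sigma> x s) y"
  shows "gap s y \<le> v \<bullet> (y - xs s)"
proof -
  have "f y + ereal (R s y) + ereal (v \<bullet> (xs s - y)) \<le> f (xs s) + ereal (R s (xs s))"
    using v by (simp add: subdifferential_def ar_objective_eq)
  then have "val y + R s y + v \<bullet> (xs s - y) \<le> val (xs s) + R s (xs s)"
    by (simp add: f_eq_val[OF subdifferential_objective(1)[OF s(2) v]] f_eq_val[OF xs_finite[OF s]])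
  then show ?thesis by (simp add: gap_def inner_diff_right)
qed

text \<open>Adding a term centered at \<open>x s\<close> pulls the minimizer towards
  \<open>x s\<close>: the two optimality inequalities leave only that term. Minimality of
  \<open>z\<close> is a hypothesis so that \<open>s = 0\<close>, where the regularizer vanishes, can
  take \<open>z = xstar\<close>.\<close>

lemma minimizer_step_le:
  assumes s: "Suc s \<le> S" and z: "f z \<noteq> \<infinity>"
    and min: "\<And>w. f w \<noteq> \<infinity> \<Longrightarrow> val z + R s z \<le> val w + R s w"
  shows "norm (xs (Suc s) - x s) \<le> norm (z - x s)"
proof -
  have fin: "f (xs (Suc s)) \<noteq> \<infinity>" using xs_finite[of "Suc s"] s by simp
  have "(\<sigma> (Suc s) - \<sigma> s) / (real p + 1) * norm (xs (Suc s) - x s) ^ (p + 1)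
      \<le> (\<sigma> (Suc s) - \<sigma> s) / (real p + 1) * norm (z - x s) ^ (p + 1)"
    using xs_minimizes_val[of "Suc s" z] s z min[OF fin] by (simp add: ar_regularizer_Suc)
  moreover have "(\<sigma> (Suc s) - \<sigma> s) / (real p + 1) > 0" using sigma_increasing[of "Suc s"] s by simp
  ultimately have "norm (xs (Suc s) - x s) ^ Suc p \<le> norm (z - x s) ^ Suc p"
    by (simp only: mult_le_cancel_left_pos Suc_eq_plus1)
  then show ?thesis by (rule power_le_imp_le_base) simp
qed

lemma first_step_le: "1 \<le> S \<Longrightarrow> norm (xs 1 - x 0) \<le> norm (xstar - x 0)"
  using minimizer_step_le[of 0 xstar] xstar_finite xstar_le f_eq_val
  by (simp add: ar_regularizer_def) (metis ereal_less_eq(3))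

lemma next_step_le:
  assumes "1 \<le> s" "Suc s \<le> S"
  shows "norm (xs (Suc s) - x s) \<le> norm (x s - xs s)"
  using minimizer_step_le[of s "xs s"] xs_minimizes_val[of s] xs_finite[of s] assms
  by (simp add: norm_minus_commute)

text \<open>\<open>x\<^sub>s\<close> is the new center, so the term added in epoch \<open>s + 1\<close> vanishes there.\<close>

lemma next_step_le_gap:
  assumes "1 \<le> s" "Suc s \<le> S" "f (x s) \<noteq> \<infinity>"
  shows "(\<sigma> (Suc s) - \<sigma> s) / (real p + 1) * norm (xs (Suc s) - x s) ^ (p + 1) \<le> gap s (x s)"
  using xs_minimizes_val[of "Suc s" "x s"] xs_minimizes_val[of s "xs (Suc s)"] xs_finite[of "Suc s"] assms
  by (simp add: ar_regularizer_Suc gap_def)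

end

section \<open>Geometric parameters: contraction of the epochs and the final subgradient\<close>

text \<open>
  \<open>\<rho>\<close> bounds \<open>\<parallel>x\<^sub>s - x\<^sub>s\<^sup>*\<parallel> / d\<^sub>s\<close>, \<open>\<tau>\<close> bounds \<open>d\<^bsub>s+1\<^esub> / d\<^sub>s\<close>, and \<open>F\<close>
  bounds the distance of the final iterate from \<open>x\<^bsub>s-1\<^esub>\<close> relative to \<open>d\<^sub>s\<close>. The second alternative of
  \<open>tau\<close> is for \<open>p = 1\<close>, where \<open>\<tau> = \<rho>\<close> would violate \<open>\<kappa> \<tau>\<^sup>p < 1\<close>.
\<close>

locale geometric_accumulative_regularization = accumulative_regularization +
  fixes \<kappa> \<sigma>\<^sub>1 \<rho> \<tau> F D :: real
  assumes kappa: "\<kappa> \<ge> 4" and sigma1: "\<sigma>\<^sub>1 > 0" and D: "norm (xstar - x 0) \<le> D"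
    and sigma_0: "\<sigma> 0 = 0" and sigma: "s \<in> {1..S} \<Longrightarrow> \<sigma> s = \<sigma>\<^sub>1 * \<kappa> ^ (s - 1)"
    and finite_x: "s \<in> {1..S} \<Longrightarrow> f (x s) \<noteq> \<infinity>"
    and gap_le: "s \<in> {1..S} \<Longrightarrow>
      gap s (x s) \<le> \<sigma> s * norm (xs s - x (s - 1)) ^ (p + 1) / ((real p + 1) * \<kappa>\<^sup>2)"
    and rho_nonneg: "\<rho> \<ge> 0" and tau_nonneg: "\<tau> \<ge> 0"
    and rho: "8 / (3 * (real p + 1)) \<le> \<rho>\<^sup>2 * \<kappa>\<^sup>2"
    and tau: "\<rho> \<le> \<tau> \<or> 1 \<le> \<tau> ^ (p + 1) * (\<kappa>\<^sup>2 * (\<kappa> - 1))"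
    and F_tau: "1 + \<rho> + \<tau> * F \<le> F" and F_ge: "1 + 16 / (3 * (real p + 1) * 8 ^ p) \<le> F"
begin

definition d :: "nat \<Rightarrow> real" where "d s = norm (xs s - x (s - 1))"

lemma d_nonneg: "d s \<ge> 0"
  by (simp add: d_def)

lemma F_nonneg: "F \<ge> 0"
proof -
  have "16 / (3 * (real p + 1) * 8 ^ p) \<ge> 0" by simp
  then show ?thesis using F_ge by linarith
qed

lemma sigma_pos: "s \<in> {1..S} \<Longrightarrow> \<sigma> s > 0"
  using sigma sigma1 kappa by simp

lemma sigma_nonneg: "s \<le> S \<Longrightarrow> \<sigma> s \<ge> 0"
  using sigma_pos[of s] sigma_0 by (cases "s = 0") (auto simp: order_less_imp_le)

lemma sigma_Suc: "1 \<le> s \<Longrightarrow> Suc s \<le> S \<Longrightarrow> \<sigma> (Suc s) = \<kappa> * \<sigma> s"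
  by (cases s) (simp_all add: sigma)

lemma sigma_diff_ge:
  assumes "s \<in> {1..S}"
  shows "3 / 4 * \<sigma> s \<le> \<sigma> s - \<sigma> (s - 1)"
proof (cases "s = 1")
  case True
  then show ?thesis using sigma_pos[OF assms] sigma_0 by simp
next
  case False
  then have "\<sigma> s = \<kappa> * \<sigma> (s - 1)" using sigma_Suc[of "s - 1"] assms by auto
  moreover have "4 * \<sigma> (s - 1) \<le> \<kappa> * \<sigma> (s - 1)"
    using kappa sigma_nonneg[of "s - 1"] assms by (intro mult_right_mono) auto
  ultimately show ?thesis by simp
qed

text \<open>The gap lies between \<open>3 / 4 * \<sigma> s\<close> times the divergence and the
  accuracy of the epoch. \<open>\<sigma> s\<close> cancels, and \<open>rho\<close> is the condition
  that remains.\<close>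

lemma dist_center_xs:
  assumes "s \<in> {1..S}"
  shows "norm (x s - xs s) \<le> \<rho> * d s"
proof -
  let ?B = "power_bregman p (x s - x (s - 1)) (xs s - x (s - 1))"
  have "3 / 4 * \<sigma> s * ?B \<le> (\<sigma> s - \<sigma> (s - 1)) * ?B"
    using sigma_diff_ge[OF assms] power_bregman_nonneg[OF p] by (rule mult_right_mono)
  also have "\<dots> \<le> gap s (x s)" using gap_ge_bregman[of s] finite_x assms by auto
  also have "\<dots> \<le> \<sigma> s * d s ^ (p + 1) / ((real p + 1) * \<kappa>\<^sup>2)" using gap_le[OF assms] by (simp add: d_def)
  finally have "3 / 4 * \<sigma> s * ?B \<le> \<sigma> s * d s ^ (p + 1) / ((real p + 1) * \<kappa>\<^sup>2)" .
  then have "\<sigma> s * (3 / 4 * ?B) \<le> \<sigma> s * (d s ^ (p + 1) / ((real p + 1) * \<kappa>\<^sup>2))"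
    by (simp add: algebra_simps)
  then have "3 / 4 * ?B \<le> d s ^ (p + 1) / ((real p + 1) * \<kappa>\<^sup>2)"
    using sigma_pos[OF assms] by (simp only: mult_le_cancel_left_pos)
  then have "?B \<le> 4 / 3 * (d s ^ (p + 1) / ((real p + 1) * \<kappa>\<^sup>2))" by linarith
  \<comment> \<open>The 8/3 in \<open>rho\<close> is 4/3 from the weight difference times 2 from the
    halved square in \<open>dist_le_of_power_bregman_le\<close>.\<close>
  moreover have "4 / 3 * (u / (n * k)) = 8 / (3 * n) / k / 2 * u" for n k u :: real by simp
  ultimately have "?B \<le> 8 / (3 * (real p + 1)) / \<kappa>\<^sup>2 / 2 * d s ^ (p + 1)" by (simp only:)
  also have "\<dots> \<le> \<rho>\<^sup>2 / 2 * d s ^ (p + 1)"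
    using rho kappa d_nonneg by (intro mult_right_mono divide_right_mono) (auto simp: divide_le_eq mult_ac)
  finally have "?B \<le> \<rho>\<^sup>2 / 2 * norm (xs s - x (s - 1)) ^ (p + 1)" unfolding d_def .
  then have "norm ((x s - x (s - 1)) - (xs s - x (s - 1))) \<le> \<rho> * norm (xs s - x (s - 1))"
    by (rule dist_le_of_power_bregman_le[OF p rho_nonneg])
  then show ?thesis by (simp add: d_def)
qed

text \<open>The first alternative compares the new minimizer with the old one, the second with the
  new center \<open>x s\<close> itself, where the gap alone pays for the step.\<close>

lemma d_Suc_le:
  assumes s: "1 \<le> s" "Suc s \<le> S"
  shows "d (Suc s) \<le> \<tau> * d s"
  using tau
proof
  assume "\<rho> \<le> \<tau>"
  then have "\<rho> * d s \<le> \<tau> * d s" using d_nonneg by (rule mult_right_mono)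
  then show ?thesis using next_step_le[OF s] dist_center_xs[of s] s by (simp add: d_def)
next
  assume tau: "1 \<le> \<tau> ^ (p + 1) * (\<kappa>\<^sup>2 * (\<kappa> - 1))"
  have "\<sigma> s * (\<kappa> - 1) / (real p + 1) * d (Suc s) ^ (p + 1) \<le> gap s (x s)"
    using next_step_le_gap[OF s] finite_x[of s] s sigma_Suc[OF s] by (simp add: d_def algebra_simps)
  also have "\<dots> \<le> \<sigma> s * d s ^ (p + 1) / ((real p + 1) * \<kappa>\<^sup>2)" using gap_le[of s] s by (simp add: d_def)
  finally have "\<sigma> s * (\<kappa> - 1) / (real p + 1) * d (Suc s) ^ (p + 1)
      \<le> \<sigma> s * d s ^ (p + 1) / ((real p + 1) * \<kappa>\<^sup>2)" .
  moreover have "a / (n * \<kappa>\<^sup>2) * (\<kappa>\<^sup>2 * b * u) = a * b / n * u" "a / (n * \<kappa>\<^sup>2) * u = a * u / (n * \<kappa>\<^sup>2)"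
    for a b n u :: real
    using kappa by auto
  ultimately have "\<sigma> s / ((real p + 1) * \<kappa>\<^sup>2) * (\<kappa>\<^sup>2 * (\<kappa> - 1) * d (Suc s) ^ (p + 1))
      \<le> \<sigma> s / ((real p + 1) * \<kappa>\<^sup>2) * d s ^ (p + 1)"
    by (simp only:)
  moreover have "\<sigma> s / ((real p + 1) * \<kappa>\<^sup>2) > 0" using sigma_pos[of s] s kappa by simp
  ultimately have *: "\<kappa>\<^sup>2 * (\<kappa> - 1) * d (Suc s) ^ (p + 1) \<le> d s ^ (p + 1)"
    by (simp only: mult_le_cancel_left_pos)
  have "d (Suc s) ^ (p + 1) \<le> \<tau> ^ (p + 1) * (\<kappa>\<^sup>2 * (\<kappa> - 1)) * d (Suc s) ^ (p + 1)"
    using mult_right_mono[OF tau, of "d (Suc s) ^ (p + 1)"] d_nonneg by simp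
  also have "\<dots> = \<tau> ^ (p + 1) * (\<kappa>\<^sup>2 * (\<kappa> - 1) * d (Suc s) ^ (p + 1))" by (simp only: mult.assoc)
  also have "\<dots> \<le> \<tau> ^ (p + 1) * d s ^ (p + 1)"
    using * tau_nonneg by (intro mult_left_mono) auto
  finally have "d (Suc s) ^ Suc p \<le> (\<tau> * d s) ^ Suc p" by (simp only: power_mult_distrib Suc_eq_plus1)
  then show ?thesis by (rule power_le_imp_le_base) (simp add: tau_nonneg d_nonneg)
qed

lemma d_le: "s < S \<Longrightarrow> d (Suc s) \<le> \<tau> ^ s * D"
proof (induction s)
  case 0
  then show ?case using first_step_le D by (simp add: d_def)
next
  case (Suc s)
  have "\<tau> * d (Suc s) \<le> \<tau> * (\<tau> ^ s * D)" using Suc tau_nonneg by (intro mult_left_mono) auto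
  then show ?case using d_Suc_le[of "Suc s"] Suc.prems by simp
qed

text \<open>The weight grows by \<kappa> per epoch while the \<open>p\<close>-th power of the
  distance shrinks by \<open>\<tau> ^ p\<close>.\<close>

lemma sigma_d_le:
  assumes "s < S"
  shows "\<sigma> (Suc s) * d (Suc s) ^ p \<le> \<sigma>\<^sub>1 * D ^ p * (\<kappa> * \<tau> ^ p) ^ s"
proof -
  have "\<sigma> (Suc s) * d (Suc s) ^ p \<le> \<sigma> (Suc s) * (\<tau> ^ s * D) ^ p"
    using d_le[OF assms] sigma_pos[of "Suc s"] assms d_nonneg by (intro mult_left_mono power_mono) auto
  also have "\<dots> = \<sigma>\<^sub>1 * D ^ p * (\<kappa> * \<tau> ^ p) ^ s"
    using assms by (simp add: sigma power_mult_distrib power_mult[symmetric] mult.commute)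
  finally show ?thesis .
qed

text \<open>Testing the subgradient at \<open>xs S\<close> bounds the gap by
  \<open>norm v * norm (y - xs S)\<close>, which the divergence bound turns into a relative
  distance.\<close>

lemma dist_last_center:
  assumes S: "S \<ge> 1" and \<gamma>: "\<gamma> \<ge> 1"
    and v: "v \<in> subdifferential (ar_objective p f \<sigma> x S) y"
    and v_le: "norm v \<le> \<sigma> S * (2 * \<gamma> / ((real p + 1) * 8 ^ p)) * d S ^ p"
  shows "norm (y - x (S - 1)) \<le> F * \<gamma> * d S"
proof -
  let ?B = "power_bregman p (y - x (S - 1)) (xs S - x (S - 1))"
  \<comment> \<open>16/3 is the product of 4/3 (weight difference), 2 (the constant in
    \<open>v_le\<close>) and 2 (the halved square in the divergence bound).\<close>
  define \<eta> where "\<eta> = 16 / (3 * (real p + 1) * 8 ^ p) * \<gamma>"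
  have \<eta>: "\<eta> \<ge> 0" using \<gamma> by (simp add: \<eta>_def)
  have fy: "f y \<noteq> \<infinity>" using subdifferential_objective(1)[OF order_refl v] .
  have "3 / 4 * \<sigma> S * ?B \<le> (\<sigma> S - \<sigma> (S - 1)) * ?B"
    using sigma_diff_ge[of S] power_bregman_nonneg[OF p] S by (intro mult_right_mono) auto
  also have "\<dots> \<le> gap S y" using gap_ge_bregman[OF S order_refl fy] .
  also have "\<dots> \<le> v \<bullet> (y - xs S)" using inner_subgradient_ge_gap[OF S order_refl v] .
  also have "\<dots> \<le> norm v * norm (y - xs S)" by (rule norm_cauchy_schwarz)
  also have "\<dots> \<le> \<sigma> S * (2 * \<gamma> / ((real p + 1) * 8 ^ p)) * d S ^ p * norm (y - xs S)"
    using v_le by (rule mult_right_mono) simp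
  finally have "3 / 4 * \<sigma> S * ?B
      \<le> \<sigma> S * (2 * \<gamma> / ((real p + 1) * 8 ^ p)) * d S ^ p * norm (y - xs S)" .
  moreover have "a \<le> 4 / 3 * u" if "3 / 4 * a \<le> u" for a u :: real using that by simp
  ultimately have "\<sigma> S * ?B
      \<le> 4 / 3 * (\<sigma> S * (2 * \<gamma> / ((real p + 1) * 8 ^ p)) * d S ^ p * norm (y - xs S))"
    by (simp only: mult.assoc)
  moreover have "4 / 3 * (a * (2 * g / (n * k)) * u * w) = a * (16 / (3 * n * k) * g / 2 * u * w)"
    for a n k g u w :: real by (simp add: mult_ac)
  ultimately have "\<sigma> S * ?B \<le> \<sigma> S * (\<eta> / 2 * d S ^ p * norm (y - xs S))"
    by (simp only: \<eta>_def)
  then have "?B \<le> \<eta> / 2 * d S ^ p * norm (y - xs S)"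
    using sigma_pos[of S] S by simp
  then have "norm ((y - x (S - 1)) - (xs S - x (S - 1))) \<le> \<eta> * norm (xs S - x (S - 1))"
    by (intro dist_le_of_power_bregman_le_dist[OF p \<eta>]) (simp add: d_def)
  then have "norm (y - x (S - 1)) \<le> (1 + \<eta>) * d S"
    using norm_triangle_ineq[of "y - xs S" "xs S - x (S - 1)"] by (simp add: d_def algebra_simps)
  also have "1 + \<eta> \<le> F * \<gamma>"
    using mult_right_mono[OF F_ge, of \<gamma>] \<gamma> by (simp add: \<eta>_def algebra_simps)
  then have "(1 + \<eta>) * d S \<le> F * \<gamma> * d S" using d_nonneg by (rule mult_right_mono)
  finally show ?thesis .
qed

text \<open>Backward induction from the last epoch, passing through \<open>x s\<close> and
  \<open>xs s\<close>. By \<open>F_tau\<close> the recursion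
  \<open>F \<mapsto> 1 + \<rho> + \<tau> * F\<close> does not exceed \<open>F\<close>, so the
  constant stays uniform in \<open>s\<close>.\<close>

lemma dist_center:
  assumes "1 \<le> s" "s \<le> S" and \<gamma>: "\<gamma> \<ge> 1"
    and last: "norm (y - x (S - 1)) \<le> F * \<gamma> * d S"
  shows "norm (y - x (s - 1)) \<le> F * \<gamma> * d s"
  using assms(2,1)
proof (induction s rule: inc_induct)
  case base
  then show ?case using last by simp
next
  case (step s)
  have s: "1 \<le> s" "Suc s \<le> S" using step by auto
  have "norm (y - x (s - 1)) \<le> norm (y - x s) + norm (x s - xs s) + norm (xs s - x (s - 1))"
    using norm_triangle_ineq[of "y - x s" "x s - x (s - 1)"]
      norm_triangle_ineq[of "x s - xs s" "xs s - x (s - 1)"] by simp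
  also have "\<dots> \<le> F * \<gamma> * (\<tau> * d s) + \<rho> * d s + d s"
  proof -
    have "F * \<gamma> * d (Suc s) \<le> F * \<gamma> * (\<tau> * d s)"
      using d_Suc_le[OF s] F_nonneg \<gamma> by (intro mult_left_mono) auto
    then show ?thesis using step.IH s dist_center_xs[of s] by (simp add: d_def)
  qed
  also have "\<dots> = (\<tau> * F * \<gamma> + (1 + \<rho>)) * d s" by (simp add: algebra_simps)
  also have "\<dots> \<le> F * \<gamma> * d s"
  proof (rule mult_right_mono[OF _ d_nonneg])
    have "(1 + \<rho>) * 1 \<le> (1 + \<rho>) * \<gamma>" using \<gamma> rho_nonneg by (intro mult_left_mono) auto
    moreover have "(1 + \<rho> + \<tau> * F) * \<gamma> \<le> F * \<gamma>" using F_tau \<gamma> by (intro mult_right_mono) auto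
    ultimately show "\<tau> * F * \<gamma> + (1 + \<rho>) \<le> F * \<gamma>" by (simp add: algebra_simps)
  qed
  finally show ?case .
qed

text \<open>Each increment of \<sigma> is at most \<open>\<sigma> i\<close>, so
  \<open>dist_center\<close> and \<open>sigma_d_le\<close> bound the terms by a geometric
  series.\<close>

lemma norm_gradient_le:
  assumes ratio: "\<kappa> * \<tau> ^ p < 1" and \<gamma>: "\<gamma> \<ge> 1"
    and last: "norm (y - x (S - 1)) \<le> F * \<gamma> * d S"
  shows "norm (G S y) \<le> \<sigma>\<^sub>1 * D ^ p * (F * \<gamma>) ^ p / (1 - \<kappa> * \<tau> ^ p)"
proof -
  have D0: "D \<ge> 0" using D norm_ge_zero order_trans by blast
  have "norm (((\<sigma> i - \<sigma> (i - 1)) * norm (y - x (i - 1)) ^ (p - 1)) *\<^sub>R (y - x (i - 1)))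
      \<le> \<sigma>\<^sub>1 * D ^ p * (F * \<gamma>) ^ p * (\<kappa> * \<tau> ^ p) ^ (i - 1)" if i: "i \<in> {1..S}" for i
  proof -
    have pos: "0 \<le> \<sigma> i - \<sigma> (i - 1)" using sigma_increasing[OF i] by simp
    have le: "\<sigma> i - \<sigma> (i - 1) \<le> \<sigma> i" using sigma_nonneg[of "i - 1"] i by auto
    have "norm (((\<sigma> i - \<sigma> (i - 1)) * norm (y - x (i - 1)) ^ (p - 1)) *\<^sub>R (y - x (i - 1)))
        = (\<sigma> i - \<sigma> (i - 1)) * norm (y - x (i - 1)) ^ p"
      using pos p by (simp add: abs_mult power_eq_if[of _ p])
    also have "\<dots> \<le> \<sigma> i * (F * \<gamma> * d i) ^ p"
      using le pos dist_center[OF _ _ \<gamma> last, of i] i by (intro mult_mono power_mono) auto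
    also have "\<dots> = (F * \<gamma>) ^ p * (\<sigma> i * d i ^ p)" by (simp add: power_mult_distrib)
    also have "\<dots> \<le> (F * \<gamma>) ^ p * (\<sigma>\<^sub>1 * D ^ p * (\<kappa> * \<tau> ^ p) ^ (i - 1))"
      using sigma_d_le[of "i - 1"] i F_nonneg \<gamma> by (intro mult_left_mono) auto
    finally show ?thesis by (simp add: ac_simps)
  qed
  then have "norm (G S y) \<le> (\<Sum>i = 1..S. \<sigma>\<^sub>1 * D ^ p * (F * \<gamma>) ^ p * (\<kappa> * \<tau> ^ p) ^ (i - 1))"
    unfolding ar_gradient_def by (rule sum_norm_le)
  also have "\<dots> = \<sigma>\<^sub>1 * D ^ p * (F * \<gamma>) ^ p * (\<Sum>i<S. (\<kappa> * \<tau> ^ p) ^ i)"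
    by (simp add: sum_distrib_left sum.atLeast1_atMost_eq)
  also have "\<dots> \<le> \<sigma>\<^sub>1 * D ^ p * (F * \<gamma>) ^ p * (1 / (1 - \<kappa> * \<tau> ^ p))"
  proof (rule mult_left_mono)
    have "(\<Sum>i<S. (\<kappa> * \<tau> ^ p) ^ i) = (1 - (\<kappa> * \<tau> ^ p) ^ S) / (1 - \<kappa> * \<tau> ^ p)"
      using ratio by (simp add: sum_gp_strict)
    also have "\<dots> \<le> 1 / (1 - \<kappa> * \<tau> ^ p)"
      using ratio kappa tau_nonneg by (intro divide_right_mono) auto
    finally show "(\<Sum>i<S. (\<kappa> * \<tau> ^ p) ^ i) \<le> 1 / (1 - \<kappa> * \<tau> ^ p)" .
  qed (use sigma1 D0 F_nonneg \<gamma> in auto)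
  finally show ?thesis by simp
qed

text \<open>Both parts receive the common factor
  \<open>\<sigma>\<^sub>1 * D ^ p * \<gamma> ^ p\<close>; the part from \<open>v\<close> is linear
  in \<gamma> and is raised by \<open>\<gamma> \<ge> 1\<close>.\<close>

lemma norm_subgradient_le:
  assumes S: "S \<ge> 1" and ratio: "\<kappa> * \<tau> ^ p < 1" and \<gamma>: "\<gamma> \<ge> 1"
    and v: "v \<in> subdifferential (ar_objective p f \<sigma> x S) y"
    and v_le: "norm v \<le> \<sigma> S * (2 * \<gamma> / ((real p + 1) * 8 ^ p)) * d S ^ p"
  shows "norm (v - G S y)
    \<le> \<sigma>\<^sub>1 * D ^ p * \<gamma> ^ p * (F ^ p / (1 - \<kappa> * \<tau> ^ p) + 2 / ((real p + 1) * 8 ^ p))"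
proof -
  have D0: "D \<ge> 0" using D norm_ge_zero order_trans by blast
  have "norm v \<le> 2 * \<gamma> / ((real p + 1) * 8 ^ p) * (\<sigma> S * d S ^ p)" using v_le by (simp add: ac_simps)
  also have "\<dots> \<le> 2 * \<gamma> / ((real p + 1) * 8 ^ p) * (\<sigma>\<^sub>1 * D ^ p)"
  proof (rule mult_left_mono)
    have "(\<kappa> * \<tau> ^ p) ^ (S - 1) \<le> 1" using ratio kappa tau_nonneg by (intro power_le_one) auto
    then have "\<sigma>\<^sub>1 * D ^ p * (\<kappa> * \<tau> ^ p) ^ (S - 1) \<le> \<sigma>\<^sub>1 * D ^ p"
      using sigma1 D0 by (intro mult_left_le) auto
    then show "\<sigma> S * d S ^ p \<le> \<sigma>\<^sub>1 * D ^ p" using sigma_d_le[of "S - 1"] S by simp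
  qed (use \<gamma> in auto)
  also have "\<dots> = \<gamma> * (\<sigma>\<^sub>1 * D ^ p * (2 / ((real p + 1) * 8 ^ p)))" by simp
  also have "\<dots> \<le> \<gamma> ^ p * (\<sigma>\<^sub>1 * D ^ p * (2 / ((real p + 1) * 8 ^ p)))"
    using self_le_power[OF \<gamma>] p sigma1 D0 by (intro mult_right_mono) auto
  finally have "norm v \<le> \<gamma> ^ p * (\<sigma>\<^sub>1 * D ^ p * (2 / ((real p + 1) * 8 ^ p)))" .
  moreover have "norm (G S y) \<le> \<sigma>\<^sub>1 * D ^ p * (F * \<gamma>) ^ p / (1 - \<kappa> * \<tau> ^ p)"
    using norm_gradient_le[OF ratio \<gamma> dist_last_center[OF S \<gamma> v v_le]] .
  ultimately show ?thesis
    using norm_triangle_ineq4[of v "G S y"] by (simp add: power_mult_distrib algebra_simps)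
qed

end

section \<open>Numerical constants\<close>

text \<open>For \<open>p \<ge> 2\<close> the witnesses are \<open>\<rho> = \<tau> = 1 / \<kappa>\<close> and \<open>F = 1 + 1 / (2 p)\<close>, which keeps \<open>F\<^sup>p\<close> bounded.\<close>

lemma ar_constants_exist:
  fixes \<kappa> :: real
  assumes p: "p \<ge> 1" and kappa: "\<kappa> = 2 powr ((3 * real p + 1) / 2)"
  obtains \<rho> \<tau> F where "\<rho> \<ge> 0" "\<tau> \<ge> 0"
    "8 / (3 * (real p + 1)) \<le> \<rho>\<^sup>2 * \<kappa>\<^sup>2" "\<rho> \<le> \<tau> \<or> 1 \<le> \<tau> ^ (p + 1) * (\<kappa>\<^sup>2 * (\<kappa> - 1))"
    "1 + \<rho> + \<tau> * F \<le> F" "1 + 16 / (3 * (real p + 1) * 8 ^ p) \<le> F"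
    "\<kappa> * \<tau> ^ p < 1" "F ^ p / (1 - \<kappa> * \<tau> ^ p) + 2 / ((real p + 1) * 8 ^ p) \<le> 4"
proof (cases "p = 1")
  case True
  \<comment> \<open>The witnesses are rounded up from the least admissible values: about 0.2887 for
    \<rho>, 1 / sqrt 48 = 0.1443 for \<tau>, and 1.29 / 0.855 = 1.5088 for \<open>F\<close>.\<close>
  then have "\<kappa> = 4" using kappa by simp
  then show ?thesis using True
    by (intro that[of "29 / 100" "145 / 1000" "151 / 100"]) (simp_all add: power2_eq_square)
next
  case False
  then have p2: "p \<ge> 2" using p by simp
  have sq: "\<kappa>\<^sup>2 = 2 * 8 ^ p"
  proof -
    have "\<kappa>\<^sup>2 = 2 powr (real (3 * p + 1))"
      by (simp add: kappa powr_power add_divide_distrib add.commute)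
    also have "\<dots> = 2 ^ (3 * p + 1)" by (rule powr_realpow) simp
    also have "\<dots> = 2 * 8 ^ p" by (simp add: power_mult)
    finally show ?thesis .
  qed
  \<comment> \<open>Since \<open>\<kappa>\<^sup>2 = 2 * 8 ^ p\<close>, this amounts to
    \<open>\<kappa> \<ge> 5 * real p\<close>.\<close>
  have grow: "25 * (real q)\<^sup>2 \<le> 2 * 8 ^ q" if "q \<ge> 2" for q :: nat
    using that
  proof (induction q rule: dec_induct)
    case (step n)
    have "real n \<ge> 2" using step by simp
    then have "(real (Suc n))\<^sup>2 \<le> (2 * real n)\<^sup>2" by (intro power_mono) auto
    also have "\<dots> \<le> 8 * (real n)\<^sup>2" by (simp add: power_mult_distrib)
    finally have "(real (Suc n))\<^sup>2 \<le> 8 * (real n)\<^sup>2" .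
    then show ?case using step.IH by simp
  qed simp
  have kp: "\<kappa> \<ge> 5 * real p"
  proof (rule power2_le_imp_le)
    show "(5 * real p)\<^sup>2 \<le> \<kappa>\<^sup>2" using grow[OF p2] by (simp add: sq power_mult_distrib)
  qed (simp add: kappa)
  have k10: "\<kappa> \<ge> 10" using kp p2 by simp
  define F where "F = 1 + 1 / (2 * real p)"
  have Fp: "F ^ p \<le> 2"
  proof -
    have "F \<le> exp (1 / (2 * real p))" unfolding F_def by (rule exp_ge_add_one_self)
    then have "F ^ p \<le> exp (1 / (2 * real p)) ^ p" by (intro power_mono) (auto simp: F_def)
    also have "\<dots> = exp (1 / 2)" using p by (simp add: exp_of_nat_mult[symmetric])
    also have "\<dots> \<le> 2"
    proof (rule power2_le_imp_le)
      have "exp (1 / 2) ^ 2 = exp (1 :: real)" by (simp add: exp_double[symmetric])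
      then show "exp (1 / 2) ^ 2 \<le> (2 :: real)\<^sup>2" using exp_le by simp
    qed simp
    finally show ?thesis .
  qed
  have ratio: "\<kappa> * (1 / \<kappa>) ^ p \<le> 1 / 10"
  proof -
    have "\<kappa> * (1 / \<kappa>) ^ p \<le> \<kappa> * (1 / \<kappa>) ^ 2"
      using k10 p2 by (intro mult_left_mono power_decreasing) auto
    also have "\<dots> \<le> 1 / 10" using k10 by (simp add: power2_eq_square)
    finally show ?thesis .
  qed
  have e: "(8 :: real) ^ p \<ge> 64" using power_increasing[of 2 p "8 :: real"] p2 by simp
  show ?thesis
  proof (rule that[of "1 / \<kappa>" "1 / \<kappa>" F])
    show "8 / (3 * (real p + 1)) \<le> (1 / \<kappa>)\<^sup>2 * \<kappa>\<^sup>2"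
      using k10 p2 by (simp add: power2_eq_square divide_le_eq)
    \<comment> \<open>Equivalent to \<open>(1 + F) / \<kappa> \<le> 1 / (2 * real p)\<close>, which
      follows from \<open>\<kappa> \<ge> 5 * real p\<close> and
      \<open>1 + F \<le> 5 / 2\<close>.\<close>
    show "1 + 1 / \<kappa> + 1 / \<kappa> * F \<le> F"
    proof -
      have "1 / \<kappa> * (1 + F) \<le> 1 / (5 * real p) * (1 + F)"
        using kp k10 p2 by (intro mult_right_mono divide_left_mono) (auto simp: F_def)
      also have "\<dots> \<le> 1 / (5 * real p) * (5 / 2)"
        using p2 by (intro mult_left_mono) (auto simp: F_def field_simps)
      finally show ?thesis by (simp add: F_def algebra_simps)
    qed
    show "1 + 16 / (3 * (real p + 1) * 8 ^ p) \<le> F"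
    proof -
      have "3 * (real p + 1) * 64 \<le> 3 * (real p + 1) * 8 ^ p" using e by (intro mult_left_mono) auto
      then have "16 * (2 * real p) \<le> 3 * (real p + 1) * 8 ^ p" by (simp add: algebra_simps)
      then show ?thesis using p2 by (simp add: F_def field_simps)
    qed
    show "\<kappa> * (1 / \<kappa>) ^ p < 1" using ratio by simp
    show "F ^ p / (1 - \<kappa> * (1 / \<kappa>) ^ p) + 2 / ((real p + 1) * 8 ^ p) \<le> 4"
    proof -
      have "F ^ p / (1 - \<kappa> * (1 / \<kappa>) ^ p) \<le> 2 / (9 / 10)"
        using Fp ratio by (intro frac_le) auto
      moreover have "1 * 64 \<le> (real p + 1) * 8 ^ p" using e by (intro mult_mono) auto
      then have "2 / ((real p + 1) * 8 ^ p) \<le> 1" by (simp add: divide_le_eq)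
      ultimately have "F ^ p / (1 - \<kappa> * (1 / \<kappa>) ^ p) + 2 / ((real p + 1) * 8 ^ p) \<le> 2 / (9 / 10) + 1"
        by (rule add_mono)
      then show ?thesis by (rule order_trans) simp
    qed
  qed (use k10 in auto)
qed

section \<open>Total length of the epochs\<close>

text \<open>The deficit of the geometric sum over the earlier epochs pays for the doubled last
  epoch, leaving \<open>8 * W\<close> plus \<open>S + 1\<close> from rounding;
  \<open>S + 1 \<le> 2 ^ S \<le> 4 * W\<close> absorbs the rounding.\<close>

lemma sum_epoch_lengths_le:
  fixes W :: real and N :: "nat \<Rightarrow> nat"
  assumes S: "S \<ge> 1" and W: "2 ^ S \<le> 4 * W"
    and N: "\<And>s. s \<in> {1..S} \<Longrightarrow> real (N s) \<le> 4 * W / 2 ^ (s - 1) + 1"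
  shows "real (\<Sum>s = 1..<S. N s) + 2 * real (N S) \<le> 16 * W"
proof -
  have "(\<Sum>s = 1..<S. real (N s)) \<le> (\<Sum>s = 1..<S. 4 * W / 2 ^ (s - 1) + 1)"
    by (intro sum_mono N) auto
  also have "\<dots> = 8 * W * (1 - 1 / 2 ^ (S - 1)) + (real S - 1)"
  proof -
    have "(\<Sum>i<m. 4 * W * (1 / 2) ^ i + 1) = 8 * W * (1 - (1 / 2) ^ m) + real m" for m
      by (induction m) (simp_all add: algebra_simps)
    then show ?thesis using S
      by (cases S) (simp_all add: sum.atLeast_Suc_lessThan_Suc_shift atLeast0LessThan power_one_over del: sum.op_ivl_Suc)
  qed
  finally have "real (\<Sum>s = 1..<S. N s) \<le> 8 * W - 8 * (W / 2 ^ (S - 1)) + (real S - 1)"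
    by (simp add: algebra_simps)
  moreover have "real (N S) \<le> 4 * (W / 2 ^ (S - 1)) + 1" using N[of S] S by simp
  ultimately have "real (\<Sum>s = 1..<S. N s) + 2 * real (N S) \<le> 8 * W + (real S + 1)" by linarith
  moreover have "real S + 1 \<le> 2 ^ S"
  proof -
    have "Suc S \<le> 2 ^ S" by (simp add: Suc_leI)
    then show ?thesis by (metis of_nat_le_iff of_nat_Suc of_nat_power of_nat_numeral add.commute)
  qed
  ultimately show ?thesis using W by simp
qed

section \<open>Accuracy and oracle complexity for the prescribed parameters\<close>

text \<open>Accuracy holds for all sufficiently long epochs, whereas longer epochs cost more calls;
  hence the count is stated for the minimal lengths. \<open>c \<ge> 4\<close> yields
  \<open>\<gamma> \<ge> 1\<close>, and \<open>D > 0\<close> makes the weights positive.\<close>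

theorem theorem3p7:
  fixes p q S :: nat
    and g :: "real ^ 'n \<Rightarrow> real"
    and h f :: "real ^ 'n \<Rightarrow> ereal"
    and L c D \<epsilon> :: real
    and x0 :: "real ^ 'n"
    and A :: "(real ^ 'n) subroutine"
    and \<sigma> :: "nat \<Rightarrow> real"
    and N :: "nat \<Rightarrow> nat"
    and x xs y v \<nu> :: "nat \<Rightarrow> real ^ 'n"
  assumes p: "p \<ge> 1"
    and g: "proper_closed_convex (\<lambda>z. ereal (g z))"
    and h: "proper_closed_convex h"
    and f: "f = (\<lambda>z. ereal (g z) + h z)"
    and smooth: "times_continuously_differentiable p g"
    and L: "L > 0"
    and Lipschitz: "\<And>u w. form_norm p (\<lambda>vs. higher_deriv g vs u - higher_deriv g vs w)
                              \<le> L * norm (u - w)"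
    and Xstar: "minimizers f \<noteq> {}"
    and eps: "\<epsilon> > 0"
    and D_pos: "D > 0"
    and D: "infdist x0 (minimizers f) \<le> D"
    and c: "c \<ge> 4"
    \<comment> \<open>parameters\<close>
    and S: "int S = \<lceil>2 / (3 * real p + 1) * log 2 (c * D ^ p * L / \<epsilon>)\<rceil> + 1"
    and S_pos: "S \<ge> 1"
    and sigma_0: "\<sigma> 0 = 0"
    and sigma: "\<And>s. s \<in> {1..S} \<Longrightarrow>
        \<sigma> s = 2 powr ((real s - 1) * (3 * real p + 1) / 2) * \<epsilon> / (c * D ^ p)"
    and N: "\<And>s. s \<in> {1..S} \<Longrightarrow> int (N s) \<ge> ar_min_epoch_length p c L (\<sigma> s)"
    \<comment> \<open>run of the framework\<close>
    and x: "x = ar_point A f \<sigma> N x0"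
    and xs: "xs = ar_minimizer p f \<sigma> x"
    and y: "y = ar_iterate A f \<sigma> N x0 S"
    \<comment> \<open>subroutine assumption\<close>
    and value_gap: "\<And>s. s \<in> {1..S} \<Longrightarrow>
        ar_objective p f \<sigma> x s (x s) - ar_objective p f \<sigma> x s (xs s)
          \<le> ereal (c * L * norm (xs s - x (s - 1)) ^ (p + 1) / real (N s) powr ((3 * real p + 1) / 2))"
    and v: "\<And>k. k \<in> {N S..2 * N S} \<Longrightarrow> v k \<in> subdifferential (ar_objective p f \<sigma> x S) (y k)"
    and v_min: "Min ((\<lambda>k. norm (v k)) ` {N S + 1..2 * N S})
          \<le> c * L * norm (xs S - x (S - 1)) ^ p / real (N S) powr (3 * real p / 2)"
    and calls: "\<And>s k. s \<in> {1..S} \<Longrightarrow> k \<ge> 1 \<Longrightarrow> ar_oracle_calls A f \<sigma> N x0 s k \<le> q"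
    \<comment> \<open>subgradients of f\<close>
    and nu: "\<nu> = (\<lambda>k. v k - (\<Sum>i = 1..S. ((\<sigma> i - \<sigma> (i - 1)) * norm (y k - x (i - 1)) ^ (p - 1))
                                    *\<^sub>R (y k - x (i - 1))))"
  shows "(\<forall>k \<in> {N S..2 * N S}. \<nu> k \<in> subdifferential f (y k))
    \<and> Min ((\<lambda>k. norm (\<nu> k)) ` {N S + 1..2 * N S}) \<le> \<epsilon>
    \<and> ((\<forall>s \<in> {1..S}. int (N s) = ar_min_epoch_length p c L (\<sigma> s)) \<longrightarrow>
         real (ar_total_oracle_calls A f \<sigma> N x0 S)
           \<le> ar_oracle_constant p c q * (L * D ^ p / \<epsilon>) powr (2 / (3 * real p + 1)))"
proof -
  define \<kappa> where "\<kappa> = 2 powr ((3 * real p + 1) / 2)"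
  define a where "a = 2 / (3 * real p + 1)"
  define \<sigma>\<^sub>1 where "\<sigma>\<^sub>1 = \<epsilon> / (c * D ^ p)"
  \<comment> \<open>\<open>\<gamma>\<close> carries the dependence on \<open>c\<close>, which reduces all estimates to the case \<open>c = 4\<close>.\<close>
  define \<gamma> where "\<gamma> = (c / 4) powr (1 / (3 * real p + 1))"
  \<comment> \<open>The minimal length of epoch \<open>s\<close> is the ceiling of
    \<open>4 * B s powr a\<close>.\<close>
  define B where "B s = (real p + 1) * c * L / \<sigma> s" for s
  obtain \<rho> \<tau> F where bounds: "\<rho> \<ge> 0" "\<tau> \<ge> 0"
    "8 / (3 * (real p + 1)) \<le> \<rho>\<^sup>2 * \<kappa>\<^sup>2" "\<rho> \<le> \<tau> \<or> 1 \<le> \<tau> ^ (p + 1) * (\<kappa>\<^sup>2 * (\<kappa> - 1))"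
    "1 + \<rho> + \<tau> * F \<le> F" "1 + 16 / (3 * (real p + 1) * 8 ^ p) \<le> F"
    "\<kappa> * \<tau> ^ p < 1" "F ^ p / (1 - \<kappa> * \<tau> ^ p) + 2 / ((real p + 1) * 8 ^ p) \<le> 4"
    using ar_constants_exist[OF p \<kappa>_def] by metis
  have c0: "c > 0" using c by simp
  have a0: "a > 0" and a_inv: "1 / a = (3 * real p + 1) / 2" by (simp_all add: a_def)
  have kappa4: "\<kappa> \<ge> 4"
  proof -
    have "2 powr 2 \<le> \<kappa>" unfolding \<kappa>_def using p by (intro powr_mono) auto
    then show ?thesis by simp
  qed
  have kappa_sq: "\<kappa>\<^sup>2 = 2 powr (3 * real p + 1)"
    by (simp only: \<kappa>_def power2_eq_square powr_add[symmetric] field_sum_of_halves)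
  have sigma1: "\<sigma>\<^sub>1 > 0" using eps c0 D_pos by (simp add: \<sigma>\<^sub>1_def)
  have sig: "\<sigma> s = \<sigma>\<^sub>1 * \<kappa> ^ (s - 1)" if s: "s \<in> {1..S}" for s
  proof -
    have "\<kappa> ^ (s - 1) = 2 powr ((real s - 1) * (3 * real p + 1) / 2)"
      using s by (simp add: \<kappa>_def powr_power of_nat_diff mult.commute)
    then show ?thesis using sigma[OF s] by (simp add: \<sigma>\<^sub>1_def)
  qed
  have sig_pos: "\<sigma> s > 0" if "s \<in> {1..S}" for s using sig[OF that] sigma1 kappa4 by simp
  have incr: "\<sigma> (i - 1) < \<sigma> i" if i: "i \<in> {1..S}" for i
  proof (cases "i = 1")
    case True
    then show ?thesis using sig_pos[OF i] sigma_0 by simp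
  next
    case False
    then have "i - 1 \<in> {1..S}" using i unfolding atLeastAtMost_iff by linarith
    then have "\<sigma> (i - 1) = \<sigma>\<^sub>1 * \<kappa> ^ (i - 2)" using sig by (simp add: numeral_2_eq_2)
    moreover have "\<kappa> ^ (i - 2) < \<kappa> ^ (i - 1)" using kappa4 False i by (intro power_strict_increasing) auto
    ultimately show ?thesis using sig[OF i] sigma1 by simp
  qed
  have cont: "continuous_on UNIV g"
    using smooth by (auto simp: times_continuously_differentiable_def dest!: spec[of _ "[]"])
  have f_pcc: "proper_closed_convex f"
    using g h closed_ereal_epigraph_add[OF _ cont, of h] convex_ereal_epigraph_add[of h g]
    by (auto simp: proper_closed_convex_def f)
  obtain z0 where z0: "f z0 \<noteq> \<infinity>" using f_pcc by (auto simp: proper_closed_convex_def)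
  have "closed (minimizers f)"
    using f_pcc by (intro closed_minimizers[of f z0] z0) (auto simp: proper_closed_convex_def)
  then obtain xstar where xstar: "xstar \<in> minimizers f" "infdist x0 (minimizers f) = dist x0 xstar"
    using infdist_attains_inf[of "minimizers f" x0] Xstar by metis
  have x0_le: "norm (xstar - x 0) \<le> D"
    using D xstar(2) by (simp add: x ar_point_0 dist_norm norm_minus_commute)
  have sigS: "\<sigma> S = 2 powr ((real S - 1) * (3 * real p + 1) / 2) * \<epsilon> / (c * D ^ p)"
    using S_pos by (intro sigma) simp
  interpret accumulative_regularization p S f \<sigma> x xs xstar
    by unfold_locales (use p f_pcc xstar incr xs in auto)
  have N_ge: "4 * B s powr a \<le> real (N s)" if "s \<in> {1..S}" for s
    using N[OF that] unfolding ar_min_epoch_length_def B_def a_def ceiling_le_iff by simp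
  have B_pos: "B s > 0" if "s \<in> {1..S}" for s using sig_pos[OF that] c0 L by (simp add: B_def)
  have N_pos: "N s \<ge> 1" if "s \<in> {1..S}" for s
  proof -
    have "0 < 4 * B s powr a" using B_pos[OF that] by simp
    also have "\<dots> \<le> real (N s)" using N_ge[OF that] .
    finally show ?thesis by simp
  qed
  \<comment> \<open>Used twice: with \<open>r = 1\<close> for the value gap, and with
    \<open>r\<close> a root of \<open>B S\<close> for the subgradient.\<close>
  have cancel: "c * L * u / (k * (n * c * L / t / r)) = t * u / (n * k) * r" for k n t r u
    using c0 L by (simp add: mult_ac)
  have gap: "f (x s) \<noteq> \<infinity> \<and> gap s (x s) \<le> \<sigma> s * norm (xs s - x (s - 1)) ^ (p + 1) / ((real p + 1) * \<kappa>\<^sup>2)"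
    if s: "s \<in> {1..S}" for s
  proof -
    let ?d = "norm (xs s - x (s - 1)) ^ (p + 1)"
    have s': "1 \<le> s" "s \<le> S" using s by auto
    have gap: "f (x s) + ereal (R s (x s)) - (f (xs s) + ereal (R s (xs s)))
        \<le> ereal (c * L * ?d / real (N s) powr ((3 * real p + 1) / 2))"
      using value_gap[OF s] by (simp only: ar_objective_eq)
    then have fin: "f (x s) \<noteq> \<infinity>" by (auto simp: f_eq_val[OF xs_finite[OF s']])
    \<comment> \<open>The factor 4 in the epoch length becomes \<open>\<kappa>\<^sup>2\<close> under
      the exponent \<open>1 / a\<close>.\<close>
    have "\<kappa>\<^sup>2 * B s = (4 * B s powr a) powr ((3 * real p + 1) / 2)"
    proof -
      have "(4 :: real) powr ((3 * real p + 1) / 2) = (2 powr 2) powr ((3 * real p + 1) / 2)" by simp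
      also have "\<dots> = \<kappa>\<^sup>2" unfolding powr_powr kappa_sq
        by (rule arg_cong[of _ _ "\<lambda>e. 2 powr e"]) (simp add: field_simps)
      finally show ?thesis using B_pos[OF s] by (simp add: powr_mult powr_powr a_def)
    qed
    also have "\<dots> \<le> real (N s) powr ((3 * real p + 1) / 2)"
      using N_ge[OF s] by (intro powr_mono2) auto
    finally have Ns: "\<kappa>\<^sup>2 * B s \<le> real (N s) powr ((3 * real p + 1) / 2)" .
    have "gap s (x s) \<le> c * L * ?d / real (N s) powr ((3 * real p + 1) / 2)"
      using gap by (simp add: f_eq_val[OF xs_finite[OF s']] f_eq_val[OF fin] gap_def)
    also have "\<dots> \<le> c * L * ?d / (\<kappa>\<^sup>2 * B s)"
      using Ns B_pos[OF s] kappa4 c0 L N_pos[OF s] by (intro divide_left_mono mult_pos_pos) auto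
    also have "\<dots> = \<sigma> s * ?d / ((real p + 1) * \<kappa>\<^sup>2)"
      unfolding B_def using cancel[of ?d "\<kappa>\<^sup>2" "real p + 1" "\<sigma> s" 1] by (simp only: div_by_1 mult_1_right)
    finally show ?thesis using fin by simp
  qed
  interpret geometric_accumulative_regularization p S f \<sigma> x xs xstar \<kappa> \<sigma>\<^sub>1 \<rho> \<tau> F D
  proof unfold_locales
    show "norm (xstar - x 0) \<le> D" by (rule x0_le)
  qed (use bounds kappa4 sigma1 sigma_0 sig gap in auto)
  have nu_eq: "\<nu> k = v k - G S (y k)" for k by (simp add: nu ar_gradient_def)
  have part1: "\<nu> k \<in> subdifferential f (y k)" if "k \<in> {N S..2 * N S}" for k
    using subdifferential_objective(2)[OF order_refl v[OF that]] by (simp add: nu_eq)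

  define Y where "Y = (c * D ^ p * L / \<epsilon>) powr a"
  have Y0: "Y > 0" using c0 D_pos L eps by (simp add: Y_def)
  have S_eq: "int S = \<lceil>log 2 Y\<rceil> + 1" using S c0 D_pos L eps by (simp add: Y_def a_def log_powr)
  have S_S: "S \<in> {1..S}" using S_pos by simp
  \<comment> \<open>The purpose of the choice of \<open>S\<close>:
    \<open>2 powr (real S - 1)\<close> is at least \<open>Y\<close>, and the power
    \<open>1 / a\<close> translates this into a last weight of at least \<open>L\<close>.\<close>
  have sigS_ge: "\<sigma> S \<ge> L"
  proof -
    have "log 2 Y \<le> real S - 1" using S_eq by linarith
    then have "Y \<le> 2 powr (real S - 1)" using Y0 by (simp add: log_le_iff)
    then have "Y powr (1 / a) \<le> (2 powr (real S - 1)) powr (1 / a)" using Y0 a0 by (intro powr_mono2) auto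
    moreover have "Y powr (1 / a) = c * D ^ p * L / \<epsilon>"
      using a0 c0 D_pos L eps by (simp add: Y_def powr_powr)
    moreover have "(2 powr (real S - 1)) powr (1 / a) = 2 powr ((real S - 1) * (3 * real p + 1) / 2)"
      by (simp only: powr_powr a_inv times_divide_eq_right)
    ultimately have "c * D ^ p * L / \<epsilon> \<le> 2 powr ((real S - 1) * (3 * real p + 1) / 2)" by simp
    then have "c * D ^ p * L / \<epsilon> * (\<epsilon> / (c * D ^ p))
        \<le> 2 powr ((real S - 1) * (3 * real p + 1) / 2) * (\<epsilon> / (c * D ^ p))"
      using eps c0 D_pos by (intro mult_right_mono) auto
    moreover have "c * D ^ p * L / \<epsilon> * (\<epsilon> / (c * D ^ p)) = L" using eps c0 D_pos by simp
    ultimately show ?thesis by (simp only: sigS times_divide_eq_right)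
  qed
  have gam1: "\<gamma> \<ge> 1" using c by (simp add: \<gamma>_def ge_one_powr_ge_zero)
  have gam_pow: "\<gamma> ^ (3 * p + 1) = c / 4"
  proof -
    have "\<gamma> ^ (3 * p + 1) = (c / 4) powr (1 / (3 * real p + 1) * real (3 * p + 1))"
      using c0 by (simp only: \<gamma>_def powr_power) simp
    also have "1 / (3 * real p + 1) * real (3 * p + 1) = 1" by simp
    finally show ?thesis using c0 by simp
  qed
  \<comment> \<open>The subgradient rate has exponent 3p/2 rather than (3p+1)/2, which costs this
    root of \<open>B S\<close>. It is bounded because \<open>\<sigma> S \<ge> L\<close> gives
    \<open>B S \<le> (real p + 1) * c\<close>.\<close>
  have B_root: "B S powr (1 / (3 * real p + 1)) \<le> 2 * \<gamma>"
  proof -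
    have "B S \<le> (real p + 1) * c * L / L"
      unfolding B_def using sigS_ge L c0 by (intro divide_left_mono) auto
    also have "\<dots> = 4 * (real p + 1) * \<gamma> ^ (3 * p + 1)" unfolding gam_pow using L by simp
    also have "\<dots> \<le> 2 ^ (3 * p + 1) * \<gamma> ^ (3 * p + 1)"
    proof (rule mult_right_mono)
      have "4 * (q + 1) \<le> 2 ^ (3 * q + 1)" if "q \<ge> 1" for q :: nat
        using that by (induction q rule: dec_induct) (auto simp: power_add)
      from this[OF p] have "real (4 * (p + 1)) \<le> real (2 ^ (3 * p + 1))" by (simp only: of_nat_le_iff)
      then show "4 * (real p + 1) \<le> 2 ^ (3 * p + 1)" by simp
    qed (use gam1 in simp)
    also have "\<dots> = (2 * \<gamma>) ^ (3 * p + 1)" by (rule power_mult_distrib[symmetric])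
    also have "\<dots> = (2 * \<gamma>) powr real (3 * p + 1)" using gam1 by (intro powr_realpow[symmetric]) simp
    also have "real (3 * p + 1) = 3 * real p + 1" by simp
    finally have "B S powr (1 / (3 * real p + 1)) \<le> ((2 * \<gamma>) powr (3 * real p + 1)) powr (1 / (3 * real p + 1))"
      using B_pos[OF S_S] by (intro powr_mono2) auto
    also have "\<dots> = 2 * \<gamma>" using gam1 by (simp add: powr_powr)
    finally show ?thesis .
  qed
  \<comment> \<open>The index with the smallest \<open>v k\<close> may differ from the one with the
    smallest \<open>\<nu> k\<close>, but bounding \<open>\<nu>\<close> there bounds the
    minimum.\<close>
  have "Min ((\<lambda>k. norm (v k)) ` {N S + 1..2 * N S}) \<in> (\<lambda>k. norm (v k)) ` {N S + 1..2 * N S}"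
    using N_pos[OF S_S] by (intro Min_in) auto
  then obtain k where k: "k \<in> {N S + 1..2 * N S}"
    and vk: "norm (v k) \<le> c * L * norm (xs S - x (S - 1)) ^ p / real (N S) powr (3 * real p / 2)"
    using v_min by auto
  have "norm (v k) \<le> \<sigma> S * (2 * \<gamma> / ((real p + 1) * 8 ^ p)) * d S ^ p"
  proof -
    \<comment> \<open>\<open>a * (3 * real p / 2)\<close> is
      \<open>1 - 1 / (3 * real p + 1)\<close>, and 4 to the power 3p/2 is
      \<open>8 ^ p\<close>.\<close>
    have e: "(4 * B S powr a) powr (3 * real p / 2) = 8 ^ p * (B S / B S powr (1 / (3 * real p + 1)))"
    proof -
      have "(4 :: real) powr (3 * real p / 2) = (2 powr 2) powr (3 * real p / 2)" by simp
      also have "\<dots> = (2 powr 3) powr real p" unfolding powr_powr by simp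
      also have "\<dots> = 8 ^ p" by (simp add: powr_realpow)
      finally have "(4 :: real) powr (3 * real p / 2) = 8 ^ p" .
      moreover have "(B S powr a) powr (3 * real p / 2) = B S powr (1 - 1 / (3 * real p + 1))"
        unfolding powr_powr by (rule arg_cong[of _ _ "\<lambda>e. B S powr e"]) (simp add: a_def field_simps)
      ultimately show ?thesis using B_pos[OF S_S] by (simp add: powr_mult powr_diff)
    qed
    have pos: "0 < 8 ^ p * (B S / B S powr (1 / (3 * real p + 1)))" using B_pos[OF S_S] by simp
    have le: "8 ^ p * (B S / B S powr (1 / (3 * real p + 1))) \<le> real (N S) powr (3 * real p / 2)"
      unfolding e[symmetric] using N_ge[OF S_S] by (intro powr_mono2) auto
    note vk
    also have "c * L * norm (xs S - x (S - 1)) ^ p / real (N S) powr (3 * real p / 2)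
        \<le> c * L * d S ^ p / (8 ^ p * (B S / B S powr (1 / (3 * real p + 1))))"
      unfolding d_def using c0 L by (intro divide_left_mono[OF le] mult_pos_pos[OF order_less_le_trans[OF pos le] pos]) simp
    also have "\<dots> = \<sigma> S * d S ^ p / ((real p + 1) * 8 ^ p) * B S powr (1 / (3 * real p + 1))"
      unfolding B_def by (rule cancel)
    also have "\<dots> \<le> \<sigma> S * d S ^ p / ((real p + 1) * 8 ^ p) * (2 * \<gamma>)"
      using B_root sig_pos[OF S_S] d_nonneg by (intro mult_left_mono) auto
    finally show ?thesis by (simp add: ac_simps)
  qed
  then have "norm (\<nu> k) \<le> \<sigma>\<^sub>1 * D ^ p * \<gamma> ^ p * (F ^ p / (1 - \<kappa> * \<tau> ^ p) + 2 / ((real p + 1) * 8 ^ p))"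
    unfolding nu_eq using k by (intro norm_subgradient_le S_pos bounds gam1 v) auto
  also have "\<dots> \<le> \<sigma>\<^sub>1 * D ^ p * \<gamma> ^ p * 4"
    using bounds(8) sigma1 D_pos gam1 by (intro mult_left_mono) auto
  \<comment> \<open>Raising the exponent makes \<open>gam_pow\<close> applicable:
    \<open>c / 4\<close> cancels the \<open>c\<close> in \<open>\<sigma>\<^sub>1\<close> and the
    factor 4.\<close>
  also have "\<dots> \<le> \<sigma>\<^sub>1 * D ^ p * \<gamma> ^ (3 * p + 1) * 4"
    using sigma1 D_pos gam1 by (intro mult_right_mono mult_left_mono power_increasing) auto
  also have "\<dots> = \<epsilon>" using c0 D_pos by (simp only: gam_pow) (simp add: \<sigma>\<^sub>1_def)
  finally have part2: "Min ((\<lambda>k. norm (\<nu> k)) ` {N S + 1..2 * N S}) \<le> \<epsilon>"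
    using k by (intro order_trans[OF Min_le]) auto

  have part3: "real (ar_total_oracle_calls A f \<sigma> N x0 S)
      \<le> ar_oracle_constant p c q * (L * D ^ p / \<epsilon>) powr (2 / (3 * real p + 1))"
    if Neq: "\<forall>s \<in> {1..S}. int (N s) = ar_min_epoch_length p c L (\<sigma> s)"
  proof -
    \<comment> \<open>\<open>4 * W / 2 ^ (s - 1)\<close> is the length of epoch \<open>s\<close>
      before rounding, since \<open>\<kappa> powr a = 2\<close>.\<close>
    define W where "W = ((real p + 1) * c\<^sup>2 * (L * D ^ p / \<epsilon>)) powr a"
    have W_eq: "W = ((real p + 1) * c\<^sup>2) powr a * (L * D ^ p / \<epsilon>) powr a"
      unfolding W_def by (rule powr_mult)
    have "2 ^ S \<le> 4 * Y"
    proof -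
      \<comment> \<open>The ceiling adds less than 1 and the definition of \<open>S\<close> adds 1
        more, hence the offset 2 and the factor 4.\<close>
      have "real S - 2 \<le> log 2 Y" using S_eq by linarith
      then have "2 powr (real S - 2) \<le> Y" using Y0 by (simp add: le_log_iff)
      then show ?thesis by (simp add: powr_diff powr_realpow)
    qed
    also have "Y \<le> W"
    proof -
      have "1 * 1 \<le> (real p + 1) * c" using c by (intro mult_mono) auto
      then have "1 * c \<le> (real p + 1) * c * c" using c by (intro mult_right_mono) auto
      then have "c * (L * D ^ p / \<epsilon>) \<le> (real p + 1) * c\<^sup>2 * (L * D ^ p / \<epsilon>)"
        using L D_pos eps by (intro mult_right_mono) (auto simp: power2_eq_square)
      then show ?thesis
        unfolding Y_def W_def using a0 c0 L D_pos eps by (intro powr_mono2) (auto simp: ac_simps)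
    qed
    finally have W: "2 ^ S \<le> 4 * W" by simp
    have "real (N s) \<le> 4 * W / 2 ^ (s - 1) + 1" if s: "s \<in> {1..S}" for s
    proof -
      have "B s = (real p + 1) * c\<^sup>2 * (L * D ^ p / \<epsilon>) / \<kappa> ^ (s - 1)"
        using c0 by (simp add: B_def sig[OF s] \<sigma>\<^sub>1_def power2_eq_square)
      moreover have "(\<kappa> ^ (s - 1)) powr a = 2 ^ (s - 1)"
      proof -
        have "(\<kappa> ^ n) powr a = (\<kappa> powr a) ^ n" for n
          using kappa4 by (induction n) (simp_all add: powr_mult)
        then have "(\<kappa> ^ (s - 1)) powr a = (\<kappa> powr a) ^ (s - 1)" .
        also have "\<kappa> powr a = 2" by (simp add: \<kappa>_def a_def powr_powr)
        finally show ?thesis .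
      qed
      ultimately have "B s powr a = W / 2 ^ (s - 1)" by (simp only: W_def powr_divide)
      moreover have "real (N s) \<le> 4 * B s powr a + 1"
        using Neq s unfolding ar_min_epoch_length_def B_def a_def by (smt (verit) of_int_ceiling_le_add_one of_int_of_nat_eq)
      ultimately show ?thesis by simp
    qed
    then have sumN: "real (\<Sum>s = 1..<S. N s) + 2 * real (N S) \<le> 16 * W"
      by (rule sum_epoch_lengths_le[OF S_pos W])
    have "ar_total_oracle_calls A f \<sigma> N x0 S \<le> (\<Sum>s = 1..<S. \<Sum>k = 1..N s. q) + (\<Sum>k = 1..2 * N S. q)"
      unfolding ar_total_oracle_calls_def using S_pos by (intro add_mono sum_mono calls) auto
    also have "\<dots> = q * ((\<Sum>s = 1..<S. N s) + 2 * N S)"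
      by (simp add: sum_distrib_left algebra_simps)
    finally have "real (ar_total_oracle_calls A f \<sigma> N x0 S) \<le> real (q * ((\<Sum>s = 1..<S. N s) + 2 * N S))"
      by (rule of_nat_mono)
    also have "\<dots> = real q * (real (\<Sum>s = 1..<S. N s) + 2 * real (N S))" by simp
    also have "\<dots> \<le> real q * (16 * W)" using sumN by (intro mult_left_mono) auto
    also have "\<dots> = ar_oracle_constant p c q * (L * D ^ p / \<epsilon>) powr (2 / (3 * real p + 1))"
      by (simp add: ar_oracle_constant_def W_eq a_def)
    finally show ?thesis .
  qed
  show ?thesis using part1 part2 part3 by blast
qed

end
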